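(* Let $R$ be an aperiodic vertically unbounded two-step rule, let $x\in(0,\infty)$, and let $\upsilon^-(x)\equiv\upsilon^-(t;x)$ be the function of $t\in(0,\kappa(x))$ defined in the context. Then for any step direction $\theta\in\{e,n,w,s\}$, $$H^*(x,0)=\frac{C_\theta(x,\upsilon^-(x))}{D_\theta(x,\upsilon^-(x))},$$ that is, $H^*(t;x,0)=C_\theta(t;x,\upsilon^-(t;x))/D_\theta(t;x,\upsilon^-(t;x))$.
   Context: Steps on $\mathbb Z^2$: east $(1,0)$, north $(0,1)$, west $(-1,0)$, south $(0,-1)$, abbreviated $e,n,w,s$. A two-step rule is a map $R:\{e,n,w,s\}^2\to\{0,1\}$; $R(i,j)=1$ means a step of type $i$ may be immediately followed by one of type $j$. Its transfer matrix is $T=(R(i,j))_{i,j}$. The rule is aperiodic if there is $k\ge1$ with $(T^k)_{ij}>0$ for all $i,j$. A rule is north-bound if there is always a north step between each pair of south steps, south-bound if there is always a south step between each pair of north steps, and vertically unbounded if it is neither. A walk obeying $R$ is a nonempty finite sequence of steps, starting at the origin, with arbitrary first step and with $R(i,j)=1$ for each consecutive pair $(i,j)$. The generating function of a class of walks is $\sum t^m x^a y^b$ over walks in the class, where $m$ is the length and $(a,b)$ the endpoint; the variable $t$ is often suppressed. $B_\theta$: full-plane walks obeying $R$ whose first step $j$ satisfies $R(\theta,j)=1$, containing exactly one $\theta$ step, which is their last step. $C_\theta$ (resp. $D_\theta$): full-plane walks obeying $R$ which do not (resp. do) start with a south step and contain exactly one $\theta$ step, which is their last step. $B_\theta,C_\theta,D_\theta$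 are rational functions. $H_\phi(t;x,y)$: walks obeying $R$, starting at the origin, staying in $\{(a,b):b\ge0\}$, with last step $\phi$; $H^*(t;x,y)=\sum_{\phi:\,R(\phi,s)=1}H_\phi(t;x,y)$, and $H^*(x,0)$ is its value at $y=0$. For $x,y\in(0,\infty)$, $\rho(x,y)$ is the smallest positive $t$ with $B_\theta(t;x,y)=1$ (it exists and is independent of $\theta$). For fixed $x$, $\rho(x,\cdot)$ is increasing and then decreasing on $(0,\infty)$, with limit $0$ at $0$ and at $\infty$; $\tau(x)$ is the unique point where $\partial\rho/\partial y=0$ and $\kappa(x)=\rho(x,\tau(x))$. For $0<t<\kappa(x)$, $\upsilon^-(t;x)$ is the inverse of $\rho(x,\cdot)$ restricted to $(0,\tau(x))$; thus $B_\theta(t;x,\upsilon^-(t;x))=1$, and $\upsilon^-(t;x)$ increases from $0$ (as $t\to0$) to $\tau(x)$ (as $t\to\kappa(x)$). *)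

theory Defs
  imports "HOL-Analysis.Analysis"
begin

datatype step = East | North | West | South

instance step :: finite
proof
  have "(UNIV :: step set) \<subseteq> {East, North, West, South}"
    using step.exhaust by blast
  then show "finite (UNIV :: step set)"
    by (rule finite_subset) simp
qed

fun step_vec :: "step \<Rightarrow> int \<times> int" where
  "step_vec East = (1, 0)"
| "step_vec North = (0, 1)"
| "step_vec West = (-1, 0)"
| "step_vec South = (0, -1)"

type_synonym rule = "step \<Rightarrow> step \<Rightarrow> bool"

definition transfer_matrix :: "rule \<Rightarrow> nat ^ step ^ step" where
  "transfer_matrix R = (\<chi> i j. of_bool (R i j))"

definition aperiodic :: "rule \<Rightarrow> bool" where
  "aperiodic R \<longleftrightarrow>
     (\<exists>k\<ge>1. \<forall>i j. (((**) (transfer_matrix R) ^^ k) (mat 1)) $ i $ j > 0)"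

definition walks :: "rule \<Rightarrow> step list set" where
  "walks R = {w. w \<noteq> [] \<and> successively R w}"

definition north_bound :: "rule \<Rightarrow> bool" where
  "north_bound R \<longleftrightarrow>
     (\<forall>w\<in>walks R. \<forall>i j. i < j \<and> j < length w \<and> w ! i = South \<and> w ! j = South \<longrightarrow>
        (\<exists>k. i < k \<and> k < j \<and> w ! k = North))"

definition south_bound :: "rule \<Rightarrow> bool" where
  "south_bound R \<longleftrightarrow>
     (\<forall>w\<in>walks R. \<forall>i j. i < j \<and> j < length w \<and> w ! i = North \<and> w ! j = North \<longrightarrow>
        (\<exists>k. i < k \<and> k < j \<and> w ! k = South))"

definition vertically_unbounded :: "rule \<Rightarrow> bool" where
  "vertically_unbounded R \<longleftrightarrow> \<not> north_bound R \<and> \<not> south_bound R"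

definition endpoint :: "step list \<Rightarrow> int \<times> int" where
  "endpoint w = sum_list (map step_vec w)"

text \<open>
  Since \<open>0 powi 0 = 1\<close> and \<open>0 powi b = 0\<close> for \<open>b \<noteq> 0\<close>, setting \<open>y = 0\<close> keeps exactly
  the walks ending at height 0.
\<close>

definition weight :: "real \<Rightarrow> real \<Rightarrow> real \<Rightarrow> step list \<Rightarrow> real" where
  "weight t x y w = t ^ length w * x powi fst (endpoint w) * y powi snd (endpoint w)"

text \<open>
  Generating functions are evaluated at real arguments as sums of their series. Where the
  series does not converge, \<open>infsum\<close> returns the default value 0.
\<close>

definition gf :: "step list set \<Rightarrow> real \<Rightarrow> real \<Rightarrow> real \<Rightarrow> real" where
  "gf A t x y = (\<Sum>\<^sub>\<infinity>w\<in>A. weight t x y w)"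

definition first_passage :: "rule \<Rightarrow> step \<Rightarrow> step list set" where
  "first_passage R \<theta> = {w \<in> walks R. count_list w \<theta> = 1 \<and> last w = \<theta>}"

definition B_walks :: "rule \<Rightarrow> step \<Rightarrow> step list set" where
  "B_walks R \<theta> = {w \<in> first_passage R \<theta>. R \<theta> (hd w)}"

definition C_walks :: "rule \<Rightarrow> step \<Rightarrow> step list set" where
  "C_walks R \<theta> = {w \<in> first_passage R \<theta>. hd w \<noteq> South}"

definition D_walks :: "rule \<Rightarrow> step \<Rightarrow> step list set" where
  "D_walks R \<theta> = {w \<in> first_passage R \<theta>. hd w = South}"

definition H_walks :: "rule \<Rightarrow> step \<Rightarrow> step list set" where
  "H_walks R \<phi> =
     {w \<in> walks R. (\<forall>k\<le>length w. snd (endpoint (take k w)) \<ge> 0) \<and> last w = \<phi>}"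

definition H_star :: "rule \<Rightarrow> real \<Rightarrow> real \<Rightarrow> real \<Rightarrow> real" where
  "H_star R t x y = (\<Sum>\<phi>\<in>{\<phi>. R \<phi> South}. gf (H_walks R \<phi>) t x y)"

text \<open>
  As a rational function with nonnegative series coefficients, \<open>B\<close> increases from 0 to infinity
  on its positive interval of convergence. Hence the smallest positive solution of \<open>B = 1\<close> for the
  rational function lies in that interval and is the one below; it is the same for all \<open>\<theta>\<close>.
\<close>

definition rho :: "rule \<Rightarrow> real \<Rightarrow> real \<Rightarrow> real" where
  "rho R x y = (THE r. \<forall>\<theta>. 0 < r \<and> gf (B_walks R \<theta>) r x y = 1 \<and>
     (\<forall>t. 0 < t \<and> gf (B_walks R \<theta>) t x y = 1 \<longrightarrow> r \<le> t))"

definition tau :: "rule \<Rightarrow> real \<Rightarrow> real" where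
  "tau R x = (THE y. 0 < y \<and> (rho R x has_real_derivative 0) (at y))"

definition kappa :: "rule \<Rightarrow> real \<Rightarrow> real" where
  "kappa R x = rho R x (tau R x)"

definition upsilon_minus :: "rule \<Rightarrow> real \<Rightarrow> real \<Rightarrow> real" where
  "upsilon_minus R t x = the_inv_into {0<..<tau R x} (rho R x) t"

end

theory Submission
  imports Defs "HOL-Library.Sublist"
begin

text \<open>
  Both sides of the identity are computed from one positive harmonic function. At \<open>t = rho R x y\<close> the
  weighted transfer matrix has a positive eigenvector \<open>h\<close> with eigenvalue 1, so the mass
  \<open>weight t x y w * h (last w)\<close> is conserved when a walk \<open>w\<close> is extended by one step in all permitted
  ways. If walks are stopped by some rule and no mass survives forever, the initial mass
  \<open>\<Sum>j\<in>J. weight t x y [j] * h j\<close> equals the mass of the stopped walks (\<open>total_mass_stopped\<close>).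

  Stopping at the first step \<open>\<theta>\<close> gives
  \<open>C = (\<Sum>j\<noteq>South. weight t x y [j] * h j) / h \<theta>\<close> and \<open>D = weight t x y [South] * h South / h \<theta>\<close>
  (\<open>first_passage_has_sum\<close>), as well as \<open>B = 1\<close>. Stopping at the exit from the upper half-plane, which
  happens by a south step from height 0, gives
  \<open>H_star * (weight t x y [South] * h South) = (\<Sum>j\<noteq>South. weight t x y [j] * h j)\<close> (\<open>H_star_value\<close>).
  The quotient \<open>C / D\<close> is therefore \<open>H_star\<close>, whatever \<open>\<theta>\<close> is. No mass stays in the half-plane forever
  because \<open>y < tau R x\<close>: above the axis \<open>y ^ b \<le> tau R x ^ b\<close>, and at height parameter
  \<open>tau R x\<close> the critical value \<open>kappa R x\<close> exceeds \<open>t\<close> (\<open>half_plane_decay\<close>).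

  It remains to see that \<open>rho\<close>, \<open>tau\<close> and \<open>upsilon_minus\<close> denote what they should. The eigenvector
  comes from Brouwer's theorem (\<open>perron_harmonic\<close>) and identifies \<open>rho\<close>. Each weight is
  log-linear in \<open>(t, y)\<close>, so \<open>B\<close> is convex in logarithmic coordinates and \<open>rho\<close> is log-concave
  (\<open>log_rho_concave\<close>). Vertical unboundedness provides loops of net height \<open>-1\<close> and \<open>1\<close>; they force
  \<open>rho\<close> to tend to 0 at 0 and at infinity and make its maximiser unique. Differentiability at the
  maximiser is obtained from a quadratic lower bound rather than from the implicit function theorem
  (\<open>rho_quadratic_lower_bound\<close>).
\<close>

section \<open>Weights of walks and irreducibility\<close>

lemma endpoint_append: "endpoint (u @ v) = endpoint u + endpoint v"
  by (simp add: endpoint_def)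

lemma weight_append:
  "x \<noteq> 0 \<Longrightarrow> y \<noteq> 0 \<Longrightarrow> weight t x y (u @ v) = weight t x y u * weight t x y v"
  by (simp add: weight_def endpoint_append power_add power_int_add)

lemma weight_pos: "0 < t \<Longrightarrow> 0 < x \<Longrightarrow> 0 < y \<Longrightarrow> 0 < weight t x y w"
  by (simp add: weight_def)

text \<open>
  Irreducibility is the form in which aperiodicity is used: a positive entry of a power of the
  transfer matrix is a chain of permitted steps.
\<close>
lemma aperiodic_imp_irreducible:
  assumes "aperiodic R"
  shows "R\<^sup>+\<^sup>+ i j"
proof -
  have T: "\<exists>l. R i l \<and> A $ l $ j > 0" if pos: "((**) (transfer_matrix R) A) $ i $ j > 0"
    for A :: "nat ^ step ^ step" and i j
  proof -
    have "((**) (transfer_matrix R) A) $ i $ j = (\<Sum>l\<in>UNIV. of_bool (R i l) * A $ l $ j)"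
      by (simp add: matrix_matrix_mult_def transfer_matrix_def)
    with pos have "(\<Sum>l\<in>UNIV. of_bool (R i l) * A $ l $ j) \<noteq> 0" by linarith
    then obtain l where "of_bool (R i l) * A $ l $ j \<noteq> 0"
      by (rule sum.not_neutral_contains_not_neutral)
    then show ?thesis by (intro exI[of _ l]) (auto simp: of_bool_def split: if_splits)
  qed
  have star: "(((**) (transfer_matrix R) ^^ k) (mat 1)) $ i $ j > 0 \<Longrightarrow> R\<^sup>*\<^sup>* i j" for k i j
  proof (induction k arbitrary: i)
    case 0
    then show ?case by (auto simp: mat_def split: if_splits)
  next
    case (Suc k)
    from T[OF Suc.prems[unfolded funpow.simps comp_def]] Suc.IH
    show ?case by (meson converse_rtranclp_into_rtranclp)
  qed
  from assms obtain k where k: "k \<ge> 1" "(((**) (transfer_matrix R) ^^ k) (mat 1)) $ i $ j > 0"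
    unfolding aperiodic_def by blast
  then obtain k' where k': "k = Suc k'" by (cases k) auto
  obtain l where "R i l" "(((**) (transfer_matrix R) ^^ k') (mat 1)) $ l $ j > 0"
    using T[OF k(2)[unfolded k' funpow.simps comp_def]] by blast
  with star show ?thesis by (meson rtranclp_into_tranclp2)
qed

lemma irreducible_pred: "aperiodic R \<Longrightarrow> \<exists>i. R i j"
  by (drule aperiodic_imp_irreducible[of R j j]) (auto elim: tranclp.cases)

section \<open>Positive harmonic functions\<close>

text \<open>
  A positive eigenvector, with eigenvalue 1, of the matrix whose \<open>(i, j)\<close> entry is the weight of
  the step \<open>j\<close> if \<open>j\<close> may follow \<open>i\<close> and 0 otherwise. Through \<open>h\<close>, weighted sums over walks
  become statements about a conserved quantity, as in Doob's transform of a Markov chain.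
\<close>
definition harmonic :: "rule \<Rightarrow> real \<Rightarrow> real \<Rightarrow> real \<Rightarrow> (step \<Rightarrow> real) \<Rightarrow> bool" where
  "harmonic R t x y h \<longleftrightarrow> 0 < t \<and> (\<forall>i. 0 < h i \<and> (\<Sum>j | R i j. weight t x y [j] * h j) = h i)"

text \<open>
  The existence half of the Perron--Frobenius theorem. Normalising \<open>v \<mapsto> M v\<close> to the standard simplex
  gives a continuous self-map, so Brouwer supplies an eigenvector; irreducibility carries the
  positivity of one of its coordinates to all the others. The number \<open>t\<close> is the inverse of the
  eigenvalue at length parameter 1.
\<close>
lemma perron_harmonic:
  assumes ap: "aperiodic R" and xy: "0 < x" "0 < y"
  shows "\<exists>t h. harmonic R t x y h"
proof -
  define W where "W j = weight 1 x y [j]" for j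
  have W: "W j > 0" for j unfolding W_def using xy by (intro weight_pos) auto
  define M where "M v i = (\<Sum>j | R i j. W j * v $ j)" for v :: "real^step" and i
  define S where "S = {v :: real^step. (\<forall>i. 0 \<le> v $ i) \<and> (\<Sum>i\<in>UNIV. v $ i) = 1}"
  have pos: "M v i > 0" if "\<And>j. 0 \<le> v $ j" "R i j" "v $ j > 0" for v i j
    unfolding M_def using that W by (intro sum_pos2[of _ j]) (auto intro!: mult_nonneg_nonneg simp: less_imp_le)
  have nonneg: "M v i \<ge> 0" if "\<And>j. 0 \<le> v $ j" for v i
    unfolding M_def using that W by (intro sum_nonneg mult_nonneg_nonneg) (auto simp: less_imp_le)
  have ex: "\<exists>j. v $ j > 0" if "v \<in> S" for v
  proof (rule ccontr)
    assume "\<nexists>j. v $ j > 0"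
    then have "v $ j \<le> 0" for j by (simp add: not_less)
    moreover have "0 \<le> v $ j" for j using that by (simp add: S_def)
    ultimately have "v $ j = 0" for j by (meson order_antisym)
    with that show False by (simp add: S_def)
  qed
  have tot: "(\<Sum>i\<in>UNIV. M v i) > 0" if vS: "v \<in> S" for v
  proof -
    obtain j where j: "v $ j > 0" using ex[OF vS] by blast
    obtain i where "R i j" using irreducible_pred[OF ap] by blast
    then have "M v i > 0" using pos j that by (auto simp: S_def)
    then show ?thesis using nonneg that by (intro sum_pos2[of _ i]) (auto simp: S_def)
  qed
  define f where "f v = (\<chi> i. M v i / (\<Sum>i\<in>UNIV. M v i))" for v
  have "compact S"
    unfolding compact_eq_bounded_closed
  proof
    have "norm v \<le> 1" if "v \<in> S" for v
      using norm_le_l1_cart[of v] that by (simp add: S_def)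
    then show "bounded S" by (auto simp: bounded_iff)
    show "closed S"
      unfolding S_def by (intro closed_Collect_conj closed_Collect_all closed_Collect_le closed_Collect_eq continuous_intros)
  qed
  moreover have "convex S"
    unfolding convex_def S_def
    by (auto simp: sum.distrib simp flip: sum_distrib_left)
  moreover have "axis North 1 \<in> S"
    by (auto simp: S_def axis_def)
  moreover have "continuous_on S f"
  proof -
    have "continuous_on S (\<lambda>v. M v i)" for i unfolding M_def by (intro continuous_intros)
    then show ?thesis
      unfolding f_def by (intro continuous_intros) (use tot in \<open>simp_all add: less_imp_neq[THEN not_sym]\<close>)
  qed
  moreover have "f \<in> S \<rightarrow> S"
  proof
    fix v assume v: "v \<in> S"
    have "(\<Sum>i\<in>UNIV. f v $ i) = (\<Sum>i\<in>UNIV. M v i) / (\<Sum>i\<in>UNIV. M v i)"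
      unfolding f_def by (simp only: vec_lambda_beta sum_divide_distrib[symmetric])
    also have "\<dots> = 1" using tot[OF v] by simp
    finally have one: "(\<Sum>i\<in>UNIV. f v $ i) = 1" .
    have v0: "0 \<le> v $ j" for j using v by (simp add: S_def)
    have "0 \<le> f v $ i" for i
      unfolding f_def using nonneg[OF v0] tot[OF v] by (simp add: divide_nonneg_pos)
    with one show "f v \<in> S" unfolding S_def by blast
  qed
  moreover have "S \<noteq> {}" using calculation(3) by blast
  ultimately obtain v where v: "v \<in> S" "f v = v" using brouwer[of S f] by metis
  define t where "t = inverse (\<Sum>i\<in>UNIV. M v i)"
  have t: "t > 0" using tot v by (simp add: t_def)
  have eigen: "t * M v i = v $ i" for i
    using v(2) by (simp add: f_def vec_eq_iff t_def divide_inverse mult.commute)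
  have v0: "0 \<le> v $ i" for i using v by (simp add: S_def)
  obtain j where j: "v $ j > 0" using ex v by blast
  have vpos: "v $ i > 0" for i
    using aperiodic_imp_irreducible[OF ap, of i j]
  proof (induction rule: converse_tranclp_induct)
    case (base i)
    then have "0 < t * M v i" by (intro mult_pos_pos t pos[OF v0 _ j])
    then show ?case by (simp only: eigen)
  next
    case (step i k)
    then have "0 < t * M v i" by (intro mult_pos_pos t pos[OF v0, of i k])
    then show ?case by (simp only: eigen)
  qed
  have sum: "(\<Sum>j | R i j. weight t x y [j] * v $ j) = v $ i" for i
  proof -
    have "weight t x y [j] = t * W j" for j by (simp add: W_def weight_def)
    then have "(\<Sum>j | R i j. weight t x y [j] * v $ j) = t * M v i"
      by (simp add: M_def sum_distrib_left mult.assoc)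
    then show ?thesis by (simp only: eigen)
  qed
  have "harmonic R t x y (\<lambda>i. v $ i)"
    unfolding harmonic_def by (intro conjI allI t vpos sum)
  then show ?thesis by (intro exI)
qed

section \<open>Optional stopping\<close>

text \<open>
  Walks are grown step by step, the first step being taken from \<open>J\<close>, until the predicate \<open>P\<close> fails
  for the first time: \<open>surviving R J P n\<close> are the walks of length \<open>n\<close> still running, \<open>stopped R J P\<close>
  those that have just been stopped. Both the first passages to a step and the exits from the
  half-plane are of this form.
\<close>
definition surviving :: "rule \<Rightarrow> step set \<Rightarrow> (step list \<Rightarrow> bool) \<Rightarrow> nat \<Rightarrow> step list set" where
  "surviving R J P n =
     {w \<in> walks R. length w = n \<and> hd w \<in> J \<and> (\<forall>u. u \<noteq> [] \<and> prefix u w \<longrightarrow> P u)}"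

definition stopped :: "rule \<Rightarrow> step set \<Rightarrow> (step list \<Rightarrow> bool) \<Rightarrow> step list set" where
  "stopped R J P =
     {w \<in> walks R. hd w \<in> J \<and> \<not> P w \<and> (\<forall>u. u \<noteq> [] \<and> strict_prefix u w \<longrightarrow> P u)}"

abbreviation stopped_at where
  "stopped_at R J P n \<equiv> {w \<in> stopped R J P. length w = n}"

lemma walks_snoc: "u @ [j] \<in> walks R \<longleftrightarrow> u = [] \<or> u \<in> walks R \<and> R (last u) j"
  by (auto simp: walks_def successively_append_iff)

lemma finite_length: "finite {w :: step list. Q w \<and> length w = n}"
  by (rule finite_subset[OF _ finite_lists_length_eq[of UNIV n]]) auto

lemma finite_surviving: "finite (surviving R J P n)"
  by (rule finite_subset[OF _ finite_length[of "\<lambda>_. True" n]]) (auto simp: surviving_def)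

lemma finite_stopped_at: "finite (stopped_at R J P n)"
  by (rule finite_length)

lemma strict_prefix_snoc: "strict_prefix u (w @ [j]) \<longleftrightarrow> prefix u w"
  by (auto simp: strict_prefix_def dest: prefix_length_le)

lemma surviving_snoc:
  "u \<noteq> [] \<Longrightarrow> u @ [j] \<in> surviving R J P (Suc n) \<longleftrightarrow>
     u \<in> surviving R J P n \<and> R (last u) j \<and> P (u @ [j])"
  by (auto simp: surviving_def walks_snoc)

lemma stopped_snoc:
  "u \<noteq> [] \<Longrightarrow> u @ [j] \<in> stopped_at R J P (Suc n) \<longleftrightarrow>
     u \<in> surviving R J P n \<and> R (last u) j \<and> \<not> P (u @ [j])"
  by (auto simp: stopped_def surviving_def walks_snoc strict_prefix_snoc)

text \<open>
  A set of walks obtained by adding one step to the survivors of length \<open>n\<close>; with \<open>Q = P\<close> these are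
  the survivors of length \<open>n + 1\<close>, with \<open>Q\<close> the negation of \<open>P\<close> the walks stopped at that length.
\<close>
lemma sum_one_more_step:
  assumes n: "n \<ge> 1"
    and A: "\<And>u j. u \<noteq> [] \<Longrightarrow> u @ [j] \<in> A \<longleftrightarrow> u \<in> surviving R J P n \<and> R (last u) j \<and> Q (u @ [j])"
    and len: "\<And>w. w \<in> A \<Longrightarrow> length w = Suc n"
  shows "sum f A = (\<Sum>u\<in>surviving R J P n. \<Sum>j | R (last u) j \<and> Q (u @ [j]). f (u @ [j]))"
proof -
  let ?S = "SIGMA u:surviving R J P n. {j. R (last u) j \<and> Q (u @ [j])}"
  have ne: "u \<noteq> []" if "u \<in> surviving R J P n" for u
    using that by (auto simp: surviving_def walks_def)
  have "A = (\<lambda>(u, j). u @ [j]) ` ?S"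
  proof (rule set_eqI)
    fix w
    show "w \<in> A \<longleftrightarrow> w \<in> (\<lambda>(u, j). u @ [j]) ` ?S"
    proof
      assume w: "w \<in> A"
      from len[OF w] n obtain u j where "w = u @ [j]" "u \<noteq> []"
        by (cases w rule: rev_cases) (auto, metis Suc_le_length_iff list.distinct(1) One_nat_def)
      with A[of u j] w show "w \<in> (\<lambda>(u, j). u @ [j]) ` ?S" by force
    qed (use A ne in auto)
  qed
  moreover have "inj_on (\<lambda>(u, j). u @ [j]) ?S" by (auto simp: inj_on_def)
  ultimately have "sum f A = (\<Sum>(u, j)\<in>?S. f (u @ [j]))"
    by (simp add: sum.reindex case_prod_unfold)
  then show ?thesis by (simp add: sum.Sigma finite_surviving)
qed

lemma sum_surviving_Suc:
  assumes "n \<ge> 1"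
  shows "sum f (surviving R J P (Suc n)) =
    (\<Sum>u\<in>surviving R J P n. \<Sum>j | R (last u) j \<and> P (u @ [j]). f (u @ [j]))"
  by (rule sum_one_more_step[OF assms surviving_snoc]) (auto simp: surviving_def)

lemma sum_surviving_plus_stopped:
  assumes "n \<ge> 1"
  shows "sum f (surviving R J P (Suc n)) + sum f (stopped_at R J P (Suc n)) =
    (\<Sum>u\<in>surviving R J P n. \<Sum>j | R (last u) j. f (u @ [j]))"
proof -
  have "sum f (surviving R J P (Suc n)) =
      (\<Sum>u\<in>surviving R J P n. \<Sum>j | R (last u) j \<and> P (u @ [j]). f (u @ [j]))"
    by (rule sum_surviving_Suc[OF assms])
  moreover have "sum f (stopped_at R J P (Suc n)) =
      (\<Sum>u\<in>surviving R J P n. \<Sum>j | R (last u) j \<and> \<not> P (u @ [j]). f (u @ [j]))"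
    by (rule sum_one_more_step[OF assms stopped_snoc]) auto
  moreover have "(\<Sum>j | R (last u) j \<and> P (u @ [j]). f (u @ [j])) +
      (\<Sum>j | R (last u) j \<and> \<not> P (u @ [j]). f (u @ [j])) = (\<Sum>j | R (last u) j. f (u @ [j]))" for u
    by (subst sum.union_disjoint[symmetric]) (auto intro!: sum.cong)
  ultimately show ?thesis by (simp add: sum.distrib[symmetric])
qed

lemma sum_surviving_plus_stopped_first:
  "sum f (surviving R J P 1) + sum f (stopped_at R J P 1) = (\<Sum>j\<in>J. f [j])"
proof -
  have "surviving R J P 1 \<union> stopped_at R J P 1 = (\<lambda>j. [j]) ` J"
    (is "?L = ?R")
  proof (rule set_eqI)
    fix w
    show "w \<in> ?L \<longleftrightarrow> w \<in> ?R"
    proof (cases "length w = 1")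
      case True
      then obtain j where "w = [j]" by (cases w) auto
      then show ?thesis
        by (auto simp: surviving_def stopped_def walks_def prefix_Cons strict_prefix_def)
    qed (auto simp: surviving_def)
  qed
  moreover have "surviving R J P 1 \<inter> stopped_at R J P 1 = {}"
    by (auto simp: surviving_def stopped_def walks_def)
  ultimately have "sum f (surviving R J P 1) + sum f (stopped_at R J P 1) = sum f ((\<lambda>j. [j]) ` J)"
    using sum.union_disjoint[OF finite_surviving finite_stopped_at, of R J P 1 R J P 1 f] by simp
  also have "\<dots> = (\<Sum>j\<in>J. f [j])" by (subst sum.reindex) (auto simp: inj_on_def)
  finally show ?thesis .
qed

lemma stopped_length_ge_1: "w \<in> stopped R J P \<Longrightarrow> 1 \<le> length w"
  by (cases w) (auto simp: stopped_def walks_def)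

lemma stopped_le_1: "{w \<in> stopped R J P. length w \<le> 1} = stopped_at R J P 1"
  using stopped_length_ge_1 by force

lemma sum_stopped_le_Suc:
  "sum f {w \<in> stopped R J P. length w \<le> Suc n} =
   sum f {w \<in> stopped R J P. length w \<le> n} + sum f (stopped_at R J P (Suc n))"
proof -
  have "{w \<in> stopped R J P. length w \<le> Suc n} =
      {w \<in> stopped R J P. length w \<le> n} \<union> stopped_at R J P (Suc n)"
    by auto
  moreover have "finite {w \<in> stopped R J P. length w \<le> n}"
    by (rule finite_subset[OF _ finite_lists_length_le[of UNIV n]]) auto
  ultimately show ?thesis
    using finite_stopped_at by (auto intro!: sum.union_disjoint)
qed

text \<open>
  If extending a walk in all possible ways does not increase its mass \<open>f\<close>, then the mass of the
  survivors together with everything stopped so far never exceeds what was there at the start.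
\<close>
lemma mass_decreasing:
  fixes f :: "step list \<Rightarrow> real"
  assumes "\<And>n u. u \<in> surviving R J P n \<Longrightarrow> (\<Sum>j | R (last u) j. f (u @ [j])) \<le> f u"
  shows "sum f (surviving R J P (Suc n)) + sum f {w \<in> stopped R J P. length w \<le> Suc n} \<le>
    (\<Sum>j\<in>J. f [j])"
proof (induction n)
  case 0
  then show ?case using sum_surviving_plus_stopped_first[of f R J P] stopped_le_1[of R J P] by simp
next
  case (Suc n)
  have "sum f (surviving R J P (Suc (Suc n))) + sum f (stopped_at R J P (Suc (Suc n))) \<le>
      sum f (surviving R J P (Suc n))"
    using sum_surviving_plus_stopped[of "Suc n" f R J P] assms by (simp add: sum_mono)
  with Suc show ?case by (simp add: sum_stopped_le_Suc[of f R J P "Suc n"])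
qed

lemma mass_conserved:
  fixes f :: "step list \<Rightarrow> real"
  assumes "\<And>n u. u \<in> surviving R J P n \<Longrightarrow> (\<Sum>j | R (last u) j. f (u @ [j])) = f u"
  shows "sum f (surviving R J P (Suc n)) + sum f {w \<in> stopped R J P. length w \<le> Suc n} =
    (\<Sum>j\<in>J. f [j])"
proof (rule antisym)
  show "sum f (surviving R J P (Suc n)) + sum f {w \<in> stopped R J P. length w \<le> Suc n} \<le>
      (\<Sum>j\<in>J. f [j])"
    using assms by (intro mass_decreasing) simp
  have "sum (\<lambda>w. - f w) (surviving R J P (Suc n)) +
      sum (\<lambda>w. - f w) {w \<in> stopped R J P. length w \<le> Suc n} \<le> (\<Sum>j\<in>J. - f [j])"
    using assms by (intro mass_decreasing) (simp add: sum_negf)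
  then show "(\<Sum>j\<in>J. f [j]) \<le>
      sum f (surviving R J P (Suc n)) + sum f {w \<in> stopped R J P. length w \<le> Suc n}"
    by (simp add: sum_negf)
qed

lemma has_sum_by_length:
  fixes f :: "step list \<Rightarrow> real"
  assumes nonneg: "\<And>w. w \<in> A \<Longrightarrow> 0 \<le> f w"
    and lim: "(\<lambda>n. sum f {w \<in> A. length w \<le> Suc n}) \<longlonglongrightarrow> L"
  shows "(f has_sum L) A"
proof -
  have fin: "finite {w \<in> A. length w \<le> n}" for n
    by (rule finite_subset[OF _ finite_lists_length_le[of UNIV n]]) auto
  have ex: "filterlim (\<lambda>n. {w \<in> A. length w \<le> Suc n}) (finite_subsets_at_top A) sequentially"
    unfolding filterlim_finite_subsets_at_top
  proof safe
    fix X assume X: "finite X" "X \<subseteq> A"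
    then have "\<forall>w\<in>X. length w \<le> Suc n" if "n \<ge> Max (length ` X)" for n
      using that by (metis (no_types, lifting) Max_ge finite_imageI imageI le_SucI le_trans)
    then show "\<forall>\<^sub>F n in sequentially. finite {w \<in> A. length w \<le> Suc n} \<and>
        X \<subseteq> {w \<in> A. length w \<le> Suc n} \<and> {w \<in> A. length w \<le> Suc n} \<subseteq> A"
      using X fin unfolding eventually_sequentially by (intro exI[of _ "Max (length ` X)"]) blast
  qed
  have mono: "incseq (\<lambda>n. sum f {w \<in> A. length w \<le> Suc n})"
    using nonneg fin by (intro incseq_SucI sum_mono2) auto
  have "f summable_on A"
  proof (rule nonneg_bdd_above_summable_on[OF nonneg])
    show "bdd_above (sum f ` {F. F \<subseteq> A \<and> finite F})"
    proof (rule bdd_aboveI2)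
      fix F assume F: "F \<in> {F. F \<subseteq> A \<and> finite F}"
      define n where "n = Max (length ` F)"
      have "length w \<le> Suc n" if "w \<in> F" for w
        unfolding n_def using F that by (simp add: le_SucI)
      then have "sum f F \<le> sum f {w \<in> A. length w \<le> Suc n}"
        using F nonneg fin by (intro sum_mono2) auto
      also have "\<dots> \<le> L" using incseq_le[OF mono lim] .
      finally show "sum f F \<le> L" .
    qed
  qed
  then have "(f has_sum infsum f A) A" by (rule has_sum_infsum)
  then have "(\<lambda>n. sum f {w \<in> A. length w \<le> Suc n}) \<longlonglongrightarrow> infsum f A"
    unfolding has_sum_def by (rule filterlim_compose[OF _ ex])
  with lim have "L = infsum f A" by (rule LIMSEQ_unique)
  with \<open>(f has_sum infsum f A) A\<close> show ?thesis by simp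
qed

lemma summable_by_length:
  fixes f :: "step list \<Rightarrow> real"
  assumes nonneg: "\<And>w. w \<in> A \<Longrightarrow> 0 \<le> f w"
    and bound: "\<And>n. sum f {w \<in> A. length w \<le> Suc n} \<le> C"
  shows "f summable_on A"
proof -
  have fin: "finite {w \<in> A. length w \<le> n}" for n
    by (rule finite_subset[OF _ finite_lists_length_le[of UNIV n]]) auto
  have "incseq (\<lambda>n. sum f {w \<in> A. length w \<le> Suc n})"
    using nonneg fin by (intro incseq_SucI sum_mono2) auto
  then obtain L where "(\<lambda>n. sum f {w \<in> A. length w \<le> Suc n}) \<longlonglongrightarrow> L"
    by (rule incseq_convergent[of _ C]) (use bound in simp)
  then have "(f has_sum L) A" by (rule has_sum_by_length[rotated]) (rule nonneg)
  then show ?thesis by (rule has_sum_imp_summable)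
qed

text \<open>
  Optional stopping: when the mass is conserved and none of it survives in the limit, all of the
  initial mass ends up on the stopped walks.
\<close>
lemma total_mass_stopped:
  fixes f :: "step list \<Rightarrow> real"
  assumes f: "\<And>w. 0 \<le> f w"
    and step: "\<And>n u. u \<in> surviving R J P n \<Longrightarrow> (\<Sum>j | R (last u) j. f (u @ [j])) = f u"
    and lim: "(\<lambda>n. sum f (surviving R J P (Suc n))) \<longlonglongrightarrow> 0"
  shows "(f has_sum (\<Sum>j\<in>J. f [j])) (stopped R J P)"
proof (rule has_sum_by_length)
  have eq: "sum f {w \<in> stopped R J P. length w \<le> Suc n} =
      (\<Sum>j\<in>J. f [j]) - sum f (surviving R J P (Suc n))" for n
  proof -
    have "sum f (surviving R J P (Suc n)) + sum f {w \<in> stopped R J P. length w \<le> Suc n} =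
        (\<Sum>j\<in>J. f [j])"
      by (rule mass_conserved) (erule step)
    then show ?thesis by linarith
  qed
  have "(\<lambda>n. (\<Sum>j\<in>J. f [j]) - sum f (surviving R J P (Suc n))) \<longlonglongrightarrow> (\<Sum>j\<in>J. f [j]) - 0"
    by (intro tendsto_diff tendsto_const lim)
  then show "(\<lambda>n. sum f {w \<in> stopped R J P. length w \<le> Suc n}) \<longlonglongrightarrow> (\<Sum>j\<in>J. f [j])"
    by (simp only: eq diff_0_right)
qed (rule f)

section \<open>First passages\<close>

lemma harmonic_step:
  assumes "harmonic R t x y h" "0 < x" "0 < y"
  shows "(\<Sum>j | R (last u) j. weight t x y (u @ [j]) * h (last (u @ [j]))) = weight t x y u * h (last u)"
proof -
  have "(\<Sum>j | R (last u) j. weight t x y (u @ [j]) * h (last (u @ [j]))) =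
      weight t x y u * (\<Sum>j | R (last u) j. weight t x y [j] * h j)"
    using assms(2,3) by (simp add: weight_append sum_distrib_left mult.assoc)
  with assms(1) show ?thesis by (simp only: harmonic_def)
qed

text \<open>
  Nothing is ever stopped here, so the mass of all walks of a given length does not depend on the
  length.
\<close>
lemma all_walks_mass:
  assumes h: "harmonic R t x y h" and xy: "0 < x" "0 < y"
  shows "(\<Sum>w\<in>surviving R J (\<lambda>_. True) (Suc n). weight t x y w * h (last w)) =
    (\<Sum>j\<in>J. weight t x y [j] * h j)"
proof -
  let ?f = "\<lambda>w. weight t x y w * h (last w)"
  have "sum ?f (surviving R J (\<lambda>_. True) (Suc n)) +
      sum ?f {w \<in> stopped R J (\<lambda>_. True). length w \<le> Suc n} = (\<Sum>j\<in>J. ?f [j])"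
    by (rule mass_conserved) (rule harmonic_step[OF h xy])
  then show ?thesis by (simp add: stopped_def)
qed

text \<open>
  Forbidding the step \<open>\<theta>\<close> strictly lowers the spectral radius below 1. Write \<open>L\<close> for the restricted
  operator. Every state reaches \<open>\<theta>\<close>, so \<open>L ^ N h < h\<close> everywhere for large \<open>N\<close>, and then
  \<open>g = h + L h + \<dots> + L ^ (N - 1) h\<close> satisfies \<open>L g = g - h + L ^ N h < g\<close>. As there are finitely many
  states, a single factor \<open>q < 1\<close> suffices.
\<close>
lemma killed_supersolution:
  assumes ap: "aperiodic R" and h: "harmonic R t x y h" and xy: "0 < x" "0 < y"
  shows "\<exists>g q. 0 \<le> q \<and> q < 1 \<and>
    (\<forall>i. 0 < g i \<and> (\<Sum>j | R i j \<and> j \<noteq> \<theta>. weight t x y [j] * g j) \<le> q * g i)"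
proof -
  define W where "W j = weight t x y [j]" for j
  have W: "0 < W j" for j unfolding W_def using h xy by (intro weight_pos) (auto simp: harmonic_def)
  define L where "L v i = (\<Sum>j | R i j \<and> j \<noteq> \<theta>. W j * v j)" for v :: "step \<Rightarrow> real" and i
  have hpos: "0 < h i" for i using h by (simp add: harmonic_def)
  have full: "(\<Sum>j | R i j. W j * h j) = h i" for i using h by (simp add: harmonic_def W_def)
  have L_mono: "L u i \<le> L v i" if "\<And>j. u j \<le> v j" for u v i
    unfolding L_def using W that by (intro sum_mono mult_left_mono) (auto simp: less_imp_le)
  have L_le: "L h i \<le> h i" for i
    unfolding L_def full[of i, symmetric] using W hpos
    by (intro sum_mono2) (auto intro!: mult_nonneg_nonneg simp: less_imp_le)
  have L_less: "L h i < h i" if "R i \<theta>" for i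
  proof -
    have "(\<Sum>j | R i j. W j * h j) = W \<theta> * h \<theta> + (\<Sum>j\<in>{j. R i j} - {\<theta>}. W j * h j)"
      using that by (intro sum.remove) auto
    moreover have "{j. R i j} - {\<theta>} = {j. R i j \<and> j \<noteq> \<theta>}" by auto
    ultimately have "h i = W \<theta> * h \<theta> + L h i" using full[of i] by (simp add: L_def)
    then show ?thesis using mult_pos_pos[OF W hpos, of \<theta> \<theta>] by linarith
  qed
  define u where "u n = (L ^^ n) h" for n
  have u_Suc: "u (Suc n) = L (u n)" for n by (simp add: u_def)
  have u_0: "u 0 = h" by (simp add: u_def)
  have decr: "u (Suc n) i \<le> u n i" for n i
  proof (induction n arbitrary: i)
    case 0 then show ?case using L_le by (simp add: u_Suc u_0)
  next
    case (Suc n) then show ?case unfolding u_Suc[of "Suc n"] u_Suc[of n] by (intro L_mono) (simp add: u_Suc)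
  qed
  have dec: "decseq (\<lambda>n. u n i)" for i using decr by (simp add: decseq_Suc_iff)
  have u_le: "u n i \<le> h i" for n i using decseqD[OF dec, of 0 n] by (simp add: u_0)
  have u_nonneg: "0 \<le> u n i" for n i
  proof (induction n arbitrary: i)
    case 0 then show ?case using hpos by (simp add: u_0 less_imp_le)
  next
    case (Suc n) then show ?case unfolding u_Suc L_def using W
      by (intro sum_nonneg mult_nonneg_nonneg) (auto simp: less_imp_le)
  qed
  have hit: "\<exists>n. u n i < h i" for i
    using aperiodic_imp_irreducible[OF ap, of i \<theta>]
  proof (induction rule: converse_tranclp_induct)
    case (base i)
    then show ?case using L_less[of i] by (intro exI[of _ 1]) (simp add: u_Suc u_0)
  next
    case (step i k)
    show ?case
    proof (cases "k = \<theta>")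
      case True
      with step show ?thesis using L_less[of i] by (intro exI[of _ 1]) (simp add: u_Suc u_0)
    next
      case False
      obtain n where n: "u n k < h k" using step.IH by blast
      have "L (u n) i < L h i"
        unfolding L_def
      proof (rule sum_strict_mono_ex1)
        show "\<forall>j\<in>{j. R i j \<and> j \<noteq> \<theta>}. W j * u n j \<le> W j * h j"
          using u_le W by (simp add: less_imp_le mult_left_mono)
        show "\<exists>j\<in>{j. R i j \<and> j \<noteq> \<theta>}. W j * u n j < W j * h j"
          using n W False step.hyps(1) by (intro bexI[of _ k]) auto
      qed simp
      then have "u (Suc n) i < h i" using L_le[of i] by (simp add: u_Suc)
      then show ?thesis ..
    qed
  qed
  have "\<forall>\<^sub>F n in sequentially. u n i < h i" for i
  proof -
    obtain m where m: "u m i < h i" using hit by blast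
    have "u n i < h i" if "m \<le> n" for n using decseqD[OF dec that, of i] m by linarith
    then show ?thesis unfolding eventually_sequentially by blast
  qed
  then have "\<forall>\<^sub>F n in sequentially. \<forall>i. u n i < h i" by (intro eventually_all_finite)
  then obtain N where N: "\<And>i. u N i < h i" unfolding eventually_sequentially by blast
  define g where "g i = (\<Sum>n<N. u n i)" for i
  have Npos: "N > 0" using N u_0 by (cases N) auto
  have gpos: "0 < g i" for i
    unfolding g_def using Npos u_nonneg hpos by (intro sum_pos2[of _ 0]) (auto simp: u_0)
  have Lg: "L g i = g i - h i + u N i" for i
  proof -
    have "L g i = (\<Sum>n<N. u (Suc n) i)"
      unfolding L_def g_def u_Suc sum_distrib_left by (rule sum.swap)
    also have "\<dots> = g i + u N i - u 0 i"
      using sum_lessThan_telescope[of "\<lambda>n. u n i" N] unfolding g_def sum_subtractf by linarith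
    finally show ?thesis by (simp add: u_0)
  qed
  have Lg_nonneg: "0 \<le> L g i" for i
    unfolding L_def using W gpos by (intro sum_nonneg mult_nonneg_nonneg) (auto simp: less_imp_le)
  define q where "q = Max (range (\<lambda>i. L g i / g i))"
  have q_ge: "L g i / g i \<le> q" for i unfolding q_def by (intro Max_ge) auto
  have "q \<in> range (\<lambda>i. L g i / g i)" unfolding q_def by (intro Max_in) auto
  then obtain i0 where i0: "q = L g i0 / g i0" by blast
  have "L g i0 < g i0" using Lg[of i0] N[of i0] by linarith
  then have "q < 1" using gpos by (simp add: i0)
  moreover have "0 \<le> q" using gpos[of i0] Lg_nonneg by (simp add: i0)
  moreover have "L g i \<le> q * g i" for i
    using q_ge[of i] gpos[of i] by (simp add: pos_divide_le_eq)
  ultimately show ?thesis using gpos unfolding L_def W_def by blast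
qed

text \<open>
  Read on a prefix rather than on the whole walk: a walk all of whose nonempty prefixes satisfy this
  predicate does not contain \<open>\<theta>\<close>.
\<close>
abbreviation avoids :: "step \<Rightarrow> step list \<Rightarrow> bool" where
  "avoids \<theta> \<equiv> \<lambda>w. last w \<noteq> \<theta>"

lemma stopped_avoids: "stopped R J (avoids \<theta>) = {w \<in> first_passage R \<theta>. hd w \<in> J}"
proof -
  have "(\<forall>v. v \<noteq> [] \<and> strict_prefix v (u @ [\<theta>]) \<longrightarrow> last v \<noteq> \<theta>) \<longleftrightarrow> \<theta> \<notin> set u" for u
  proof
    assume *: "\<forall>v. v \<noteq> [] \<and> strict_prefix v (u @ [\<theta>]) \<longrightarrow> last v \<noteq> \<theta>"
    show "\<theta> \<notin> set u"
    proof
      assume "\<theta> \<in> set u"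
      then obtain a b where "u = (a @ [\<theta>]) @ b" by (auto dest: split_list)
      then have "prefix (a @ [\<theta>]) u" by (rule prefixI)
      with * have "last (a @ [\<theta>]) \<noteq> \<theta>" by (metis strict_prefix_snoc snoc_eq_iff_butlast)
      then show False by simp
    qed
  next
    assume *: "\<theta> \<notin> set u"
    have "last v \<noteq> \<theta>" if "v \<noteq> []" "strict_prefix v (u @ [\<theta>])" for v
      using that * set_mono_prefix[of v u] last_in_set[of v] unfolding strict_prefix_snoc by blast
    then show "\<forall>v. v \<noteq> [] \<and> strict_prefix v (u @ [\<theta>]) \<longrightarrow> last v \<noteq> \<theta>" by blast
  qed
  moreover have "count_list (u @ [\<theta>]) \<theta> = 1 \<longleftrightarrow> \<theta> \<notin> set u" for u
    by (simp add: count_list_0_iff)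
  ultimately have "w \<in> stopped R J (avoids \<theta>) \<longleftrightarrow> w \<in> first_passage R \<theta> \<and> hd w \<in> J" for w
    unfolding stopped_def first_passage_def
    by (cases w rule: rev_cases) (auto simp: walks_def)
  then show ?thesis by blast
qed

lemma B_walks_stopped: "B_walks R \<theta> = stopped R {j. R \<theta> j} (avoids \<theta>)"
  by (auto simp: stopped_avoids B_walks_def)

lemma C_walks_stopped: "C_walks R \<theta> = stopped R (- {South}) (avoids \<theta>)"
  by (auto simp: stopped_avoids C_walks_def)

lemma D_walks_stopped: "D_walks R \<theta> = stopped R {South} (avoids \<theta>)"
  by (auto simp: stopped_avoids D_walks_def)

lemma stopped_avoids_last: "w \<in> stopped R J (avoids \<theta>) \<Longrightarrow> last w = \<theta>"
  by (simp add: stopped_def)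

lemma surviving_avoids_last: "w \<in> surviving R J (avoids \<theta>) n \<Longrightarrow> last w \<noteq> \<theta>"
  by (auto simp: surviving_def walks_def)

lemma surviving_decay:
  fixes f :: "step list \<Rightarrow> real"
  assumes q: "0 \<le> q" "q < 1"
    and step: "\<And>n u. u \<in> surviving R J P n \<Longrightarrow>
      (\<Sum>j | R (last u) j \<and> P (u @ [j]). f (u @ [j])) \<le> q * f u"
    and f: "\<And>w. 0 \<le> f w"
  shows "(\<lambda>n. sum f (surviving R J P (Suc n))) \<longlonglongrightarrow> 0"
proof (rule tendsto_sandwich)
  let ?a = "\<lambda>n. sum f (surviving R J P (Suc n))"
  show "\<forall>\<^sub>F n in sequentially. 0 \<le> ?a n" using f by (simp add: sum_nonneg)
  have "?a n \<le> q ^ n * ?a 0" for n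
  proof (induction n)
    case 0 then show ?case by simp
  next
    case (Suc n)
    have "?a (Suc n) = (\<Sum>u\<in>surviving R J P (Suc n). \<Sum>j | R (last u) j \<and> P (u @ [j]). f (u @ [j]))"
      by (rule sum_surviving_Suc) simp
    also have "\<dots> \<le> (\<Sum>u\<in>surviving R J P (Suc n). q * f u)" by (intro sum_mono step)
    also have "\<dots> = q * ?a n" by (simp add: sum_distrib_left)
    also have "\<dots> \<le> q * (q ^ n * ?a 0)" using q Suc by (intro mult_left_mono) auto
    finally show ?case by (simp add: mult.assoc)
  qed
  then show "\<forall>\<^sub>F n in sequentially. ?a n \<le> q ^ n * ?a 0" by simp
  show "(\<lambda>n. q ^ n * ?a 0) \<longlonglongrightarrow> 0"
    using q by (intro tendsto_mult_left_zero LIMSEQ_realpow_zero)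
qed simp

text \<open>
  The walks avoiding \<open>\<theta>\<close> lose their mass geometrically, so optional stopping applies. The stopped
  walks all end in \<open>\<theta>\<close>, where the mass is the weight times the constant \<open>h \<theta>\<close>. The three choices of
  \<open>J\<close> that matter give the values of \<open>B\<close>, \<open>C\<close> and \<open>D\<close>.
\<close>
lemma first_passage_has_sum:
  assumes ap: "aperiodic R" and h: "harmonic R t x y h" and xy: "0 < x" "0 < y"
  shows "(weight t x y has_sum (\<Sum>j\<in>J. weight t x y [j] * h j) / h \<theta>) (stopped R J (avoids \<theta>))"
proof -
  have t: "0 < t" and hpos: "\<And>i. 0 < h i" using h by (auto simp: harmonic_def)
  have wpos: "0 < weight t x y w" for w using t xy by (rule weight_pos)
  obtain g q where q: "0 \<le> q" "q < 1" and gpos: "\<And>i. 0 < g i"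
    and g: "\<And>i. (\<Sum>j | R i j \<and> j \<noteq> \<theta>. weight t x y [j] * g j) \<le> q * g i"
    using killed_supersolution[OF ap h xy, of \<theta>] by blast
  define K where "K = Max (range (\<lambda>i. h i / g i))"
  have K: "h i \<le> K * g i" for i
  proof -
    have "h i / g i \<le> K" unfolding K_def by (intro Max_ge) auto
    then show ?thesis using gpos[of i] by (simp add: pos_divide_le_eq)
  qed
  let ?A = "\<lambda>n. surviving R J (avoids \<theta>) (Suc n)"
  have lim: "(\<lambda>n. \<Sum>w\<in>?A n. weight t x y w * g (last w)) \<longlonglongrightarrow> 0"
  proof (rule surviving_decay[OF q])
    fix n u
    have "(\<Sum>j | R (last u) j \<and> last (u @ [j]) \<noteq> \<theta>. weight t x y (u @ [j]) * g (last (u @ [j]))) =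
        weight t x y u * (\<Sum>j | R (last u) j \<and> j \<noteq> \<theta>. weight t x y [j] * g j)"
      using xy by (simp add: weight_append sum_distrib_left mult.assoc)
    also have "\<dots> \<le> weight t x y u * (q * g (last u))"
      by (intro mult_left_mono g less_imp_le wpos)
    finally show "(\<Sum>j | R (last u) j \<and> last (u @ [j]) \<noteq> \<theta>. weight t x y (u @ [j]) * g (last (u @ [j])))
        \<le> q * (weight t x y u * g (last u))" by (simp only: ac_simps)
  next
    fix w show "0 \<le> weight t x y w * g (last w)"
      by (intro mult_nonneg_nonneg less_imp_le wpos gpos)
  qed
  have "((\<lambda>w. weight t x y w * h (last w)) has_sum (\<Sum>j\<in>J. weight t x y [j] * h j))
      (stopped R J (avoids \<theta>))"
  proof (rule total_mass_stopped[where f = "\<lambda>w. weight t x y w * h (last w)", simplified last.simps if_True simp_thms])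
    show "0 \<le> weight t x y w * h (last w)" for w by (intro mult_nonneg_nonneg less_imp_le wpos hpos)
    show "(\<lambda>n. \<Sum>w\<in>?A n. weight t x y w * h (last w)) \<longlonglongrightarrow> 0"
    proof (rule tendsto_sandwich)
      show "\<forall>\<^sub>F n in sequentially. 0 \<le> (\<Sum>w\<in>?A n. weight t x y w * h (last w))"
        by (intro always_eventually allI sum_nonneg mult_nonneg_nonneg less_imp_le wpos hpos)
      have "(\<Sum>w\<in>?A n. weight t x y w * h (last w)) \<le> (\<Sum>w\<in>?A n. weight t x y w * (K * g (last w)))" for n
        by (intro sum_mono mult_left_mono K less_imp_le wpos)
      then show "\<forall>\<^sub>F n in sequentially. (\<Sum>w\<in>?A n. weight t x y w * h (last w))
          \<le> K * (\<Sum>w\<in>?A n. weight t x y w * g (last w))"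
        by (intro always_eventually allI) (simp add: sum_distrib_left ac_simps)
      show "(\<lambda>n. K * (\<Sum>w\<in>?A n. weight t x y w * g (last w))) \<longlonglongrightarrow> 0"
        using lim by (rule tendsto_mult_right_zero)
    qed simp
  qed (rule harmonic_step[OF h xy])
  also have "?this \<longleftrightarrow> ((\<lambda>w. weight t x y w * h \<theta>) has_sum (\<Sum>j\<in>J. weight t x y [j] * h j))
      (stopped R J (avoids \<theta>))"
    by (rule has_sum_cong, drule stopped_avoids_last, simp)
  finally have "((\<lambda>w. weight t x y w * h \<theta> * (1 / h \<theta>)) has_sum
      (\<Sum>j\<in>J. weight t x y [j] * h j) * (1 / h \<theta>)) (stopped R J (avoids \<theta>))"
    by (rule has_sum_cmult_left)
  then show ?thesis using hpos[of \<theta>] by simp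
qed

text \<open>
  Summability needs only a strict supersolution of the operator with \<open>\<theta>\<close> removed, a condition that
  is stable under small changes of the weights. It is used at points where no harmonic function is
  at hand.
\<close>
lemma first_passage_summable:
  assumes t: "0 < t" and xy: "0 < x" "0 < y" and q: "q < 1"
    and gpos: "\<And>i. 0 < g i"
    and g: "\<And>i. (\<Sum>j | R i j \<and> j \<noteq> \<theta>. weight t x y [j] * g j) \<le> q * g i"
  shows "weight t x y summable_on stopped R J (avoids \<theta>)"
proof -
  have wpos: "0 < weight t x y w" for w using t xy by (rule weight_pos)
  \<comment> \<open>Changing the value at \<open>\<theta>\<close> to a small \<open>\<epsilon>\<close> uses up the slack \<open>(1 - q) g\<close>, so that the
    walks stopped at \<open>\<theta>\<close> may be counted as well.\<close>
  define \<epsilon> where "\<epsilon> = (1 - q) * Min (range g) / weight t x y [\<theta>]"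
  have "Min (range g) \<in> range g" by (intro Min_in) auto
  then have "0 < Min (range g)" using gpos by auto
  then have \<epsilon>: "0 < \<epsilon>" unfolding \<epsilon>_def using q wpos by simp
  have eps: "weight t x y [\<theta>] * \<epsilon> \<le> (1 - q) * g i" for i
  proof -
    have "weight t x y [\<theta>] * \<epsilon> = (1 - q) * Min (range g)"
      unfolding \<epsilon>_def using wpos[of "[\<theta>]"] by simp
    also have "\<dots> \<le> (1 - q) * g i" using q by (intro mult_left_mono Min_le) auto
    finally show ?thesis .
  qed
  define k where "k = g(\<theta> := \<epsilon>)"
  have kpos: "0 < k i" for i using gpos \<epsilon> by (simp add: k_def)
  have super: "(\<Sum>j | R i j. weight t x y [j] * k j) \<le> g i" for i
  proof -
    have "(\<Sum>j | R i j. weight t x y [j] * k j) \<le>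
        (\<Sum>j\<in>insert \<theta> {j. R i j \<and> j \<noteq> \<theta>}. weight t x y [j] * k j)"
      using mult_pos_pos[OF wpos kpos] by (intro sum_mono2) (auto simp: less_imp_le)
    also have "\<dots> = weight t x y [\<theta>] * \<epsilon> + (\<Sum>j | R i j \<and> j \<noteq> \<theta>. weight t x y [j] * g j)"
      by (subst sum.insert) (auto simp: k_def intro!: sum.cong)
    also have "\<dots> \<le> (1 - q) * g i + q * g i" by (intro add_mono eps g)
    also have "\<dots> = g i" by (simp add: algebra_simps)
    finally show ?thesis .
  qed
  let ?f = "\<lambda>w. weight t x y w * k (last w)"
  have fpos: "0 \<le> ?f w" for w by (intro mult_nonneg_nonneg less_imp_le wpos kpos)
  have "?f summable_on stopped R J (avoids \<theta>)"
  proof (rule summable_by_length)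
    fix n
    have "sum ?f (surviving R J (avoids \<theta>) (Suc n)) +
        sum ?f {w \<in> stopped R J (avoids \<theta>). length w \<le> Suc n} \<le> (\<Sum>j\<in>J. ?f [j])"
    proof (rule mass_decreasing)
      fix m u assume "u \<in> surviving R J (avoids \<theta>) m"
      then have "last u \<noteq> \<theta>" by (rule surviving_avoids_last)
      then have "k (last u) = g (last u)" by (simp add: k_def)
      moreover have "(\<Sum>j | R (last u) j. ?f (u @ [j])) =
          weight t x y u * (\<Sum>j | R (last u) j. weight t x y [j] * k j)"
        using xy by (simp add: weight_append sum_distrib_left mult.assoc)
      moreover have "\<dots> \<le> weight t x y u * g (last u)"
        by (intro mult_left_mono super less_imp_le wpos)
      ultimately show "(\<Sum>j | R (last u) j. ?f (u @ [j])) \<le> ?f u" by simp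
    qed
    moreover have "0 \<le> sum ?f (surviving R J (avoids \<theta>) (Suc n))" by (intro sum_nonneg fpos)
    ultimately show "sum ?f {w \<in> stopped R J (avoids \<theta>). length w \<le> Suc n} \<le> (\<Sum>j\<in>J. ?f [j])"
      by linarith
  qed (rule fpos)
  also have "?this \<longleftrightarrow> (\<lambda>w. weight t x y w * \<epsilon>) summable_on stopped R J (avoids \<theta>)"
    by (rule summable_on_cong, drule stopped_avoids_last, simp add: k_def)
  finally have "(\<lambda>w. weight t x y w * \<epsilon> * (1 / \<epsilon>)) summable_on stopped R J (avoids \<theta>)"
    by (rule summable_on_cmult_left)
  then show ?thesis using \<epsilon> by simp
qed

section \<open>The critical value of t\<close>
lemma B_walks_has_sum_1:
  assumes "aperiodic R" "harmonic R t x y h" "0 < x" "0 < y"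
  shows "(weight t x y has_sum 1) (B_walks R \<theta>)"
proof -
  have "(\<Sum>j\<in>{j. R \<theta> j}. weight t x y [j] * h j) / h \<theta> = 1"
    using assms(2) unfolding harmonic_def by (metis divide_self less_irrefl)
  with first_passage_has_sum[OF assms, of "{j. R \<theta> j}" \<theta>] show ?thesis
    by (simp only: B_walks_stopped)
qed

lemma stopped_nonempty: "w \<in> stopped R J P \<Longrightarrow> w \<noteq> []"
  by (auto simp: stopped_def walks_def)

lemma B_walks_nonempty: "w \<in> B_walks R \<theta> \<Longrightarrow> w \<noteq> []"
  by (auto simp: B_walks_stopped stopped_nonempty)

lemma weight_shrink:
  assumes "0 < c" "c \<le> 1" "0 < t" "0 < x" "0 < y" "w \<noteq> []"
  shows "weight (c * t) x y w \<le> c * weight t x y w"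
proof -
  have "c ^ length w \<le> c ^ 1"
    using assms by (intro power_decreasing) (auto simp: Suc_le_eq)
  then have "c ^ length w * weight t x y w \<le> c * weight t x y w"
    using weight_pos[of t x y w] assms by (intro mult_right_mono) auto
  then show ?thesis by (simp add: weight_def power_mult_distrib mult.assoc)
qed

lemma has_sum_dominated:
  fixes f g :: "'a \<Rightarrow> real"
  assumes g: "(g has_sum c) A" and le: "\<And>w. w \<in> A \<Longrightarrow> f w \<le> g w"
    and f: "\<And>w. w \<in> A \<Longrightarrow> 0 \<le> f w"
  shows "\<exists>d\<le>c. (f has_sum d) A"
proof -
  have "f summable_on A"
  proof (rule nonneg_bdd_above_summable_on)
    show "bdd_above (sum f ` {F. F \<subseteq> A \<and> finite F})"
    proof (rule bdd_aboveI2)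
      fix F assume F: "F \<in> {F. F \<subseteq> A \<and> finite F}"
      have "sum f F \<le> sum g F" using F le by (intro sum_mono) auto
      also have "\<dots> \<le> c"
        using F le f by (intro finite_sum_le_has_sum[OF g]) (force intro: order_trans)+
      finally show "sum f F \<le> c" .
    qed
  qed (rule f)
  then have s: "(f has_sum infsum f A) A" by (rule has_sum_infsum)
  moreover have "infsum f A \<le> c" using s g le by (rule has_sum_mono)
  ultimately show ?thesis by blast
qed

lemma has_sum_dominated_less:
  fixes f g :: "'a \<Rightarrow> real"
  assumes "(g has_sum c) A" "\<And>w. w \<in> A \<Longrightarrow> f w \<le> g w"
    "\<And>w. w \<in> A \<Longrightarrow> 0 \<le> f w" "w0 \<in> A" "f w0 < g w0"
  shows "\<exists>d<c. (f has_sum d) A"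
proof -
  obtain d where d: "(f has_sum d) A" using has_sum_dominated[OF assms(1,2,3)] by blast
  have "d < c" by (rule has_sum_strict_mono[OF d assms(1,2,4,5)])
  with d show ?thesis by blast
qed

lemma B_walks_shrink:
  assumes "(weight t x y has_sum b) (B_walks R \<theta>)" "0 < s" "s \<le> t" "0 < x" "0 < y"
  shows "\<exists>d \<le> s / t * b. (weight s x y has_sum d) (B_walks R \<theta>)"
proof (rule has_sum_dominated)
  show "((\<lambda>w. s / t * weight t x y w) has_sum s / t * b) (B_walks R \<theta>)"
    using assms(1) by (rule has_sum_cmult_right)
  fix w assume "w \<in> B_walks R \<theta>"
  then show "weight s x y w \<le> s / t * weight t x y w"
    using weight_shrink[of "s / t" t x y w] assms B_walks_nonempty[of w R \<theta>] by simp
  show "0 \<le> weight s x y w" using assms by (intro less_imp_le weight_pos)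
qed

text \<open>
  With a harmonic function at \<open>t\<close>, all the series \<open>B\<close> equal 1 there. A smaller parameter scales the
  weight of every nonempty walk down by at least the ratio of the parameters, so that \<open>B < 1\<close>; hence
  \<open>t\<close> is the least solution, for each \<open>\<theta>\<close>, and the definite description in the definition of \<open>rho\<close> denotes it.
\<close>
lemma rho_eq:
  assumes ap: "aperiodic R" and h: "harmonic R t x y h" and xy: "0 < x" "0 < y"
  shows "rho R x y = t"
proof -
  have t: "0 < t" using h by (simp add: harmonic_def)
  have one: "(weight t x y has_sum 1) (B_walks R \<theta>)" for \<theta>
    by (rule B_walks_has_sum_1[OF ap h xy])
  have least: "t \<le> s" if s: "0 < s" "gf (B_walks R \<theta>) s x y = 1" for s \<theta>
  proof (rule ccontr)
    assume "\<not> t \<le> s"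
    then have "s < t" by simp
    obtain d where d: "d \<le> s / t * 1" "(weight s x y has_sum d) (B_walks R \<theta>)"
      using B_walks_shrink[OF one s(1) _ xy, of \<theta>] \<open>s < t\<close> by auto
    have "s / t < 1" using \<open>s < t\<close> t by simp
    moreover have "d = 1" using infsumI[OF d(2)] s(2) by (simp add: gf_def)
    ultimately show False using d(1) by simp
  qed
  show ?thesis
    unfolding rho_def
  proof (rule the_equality)
    show "\<forall>\<theta>. 0 < t \<and> gf (B_walks R \<theta>) t x y = 1 \<and>
        (\<forall>s. 0 < s \<and> gf (B_walks R \<theta>) s x y = 1 \<longrightarrow> t \<le> s)"
      using t least infsumI[OF one] by (auto simp: gf_def)
    fix r
    assume r: "\<forall>\<theta>. 0 < r \<and> gf (B_walks R \<theta>) r x y = 1 \<and>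
        (\<forall>s. 0 < s \<and> gf (B_walks R \<theta>) s x y = 1 \<longrightarrow> r \<le> s)"
    then have "r \<le> t" using t infsumI[OF one] by (auto simp: gf_def)
    moreover have "t \<le> r" using r least by blast
    ultimately show "r = t" by simp
  qed
qed

lemma rho_harmonic:
  assumes "aperiodic R" "0 < x" "0 < y"
  shows "\<exists>h. harmonic R (rho R x y) x y h"
proof -
  obtain t h where h: "harmonic R t x y h" using perron_harmonic[OF assms] by blast
  with rho_eq[OF assms(1) h assms(2,3)] show ?thesis by blast
qed

lemma rho_pos: "aperiodic R \<Longrightarrow> 0 < x \<Longrightarrow> 0 < y \<Longrightarrow> 0 < rho R x y"
  using rho_harmonic[of R x y] by (auto simp: harmonic_def)

lemma B_walks_rho:
  assumes "aperiodic R" "0 < x" "0 < y"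
  shows "(weight (rho R x y) x y has_sum 1) (B_walks R \<theta>)"
  using rho_harmonic[OF assms] B_walks_has_sum_1[OF assms(1) _ assms(2,3)] by blast

text \<open>
  Bounding a single \<open>B\<close>, for any \<open>\<theta>\<close>, locates \<open>t\<close> relative to the critical value. All
  lower bounds on \<open>rho\<close> come from here.
\<close>
lemma rho_sandwich:
  assumes ap: "aperiodic R" and xy: "0 < x" "0 < y" and t: "0 < t"
    and b: "(weight t x y has_sum b) (B_walks R \<theta>)"
  shows "b \<le> 1 \<Longrightarrow> t \<le> rho R x y" and "b < 1 \<Longrightarrow> t < rho R x y"
proof -
  let ?r = "rho R x y"
  have *: "1 \<le> ?r / t * b" if le: "?r \<le> t"
  proof -
    obtain d where d: "d \<le> ?r / t * b" "(weight ?r x y has_sum d) (B_walks R \<theta>)"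
      using B_walks_shrink[OF b rho_pos[OF ap xy] le xy] by blast
    have "d = 1" using d(2) B_walks_rho[OF ap xy] by (rule has_sum_unique)
    with d(1) show ?thesis by simp
  qed
  have r: "0 < ?r" by (rule rho_pos[OF ap xy])
  show "t \<le> ?r" if "b \<le> 1"
  proof (rule ccontr)
    assume "\<not> t \<le> ?r"
    then have "?r / t < 1" using t by simp
    moreover have "?r / t * b \<le> ?r / t * 1" using that r t by (intro mult_left_mono) auto
    ultimately show False using * \<open>\<not> t \<le> ?r\<close> by simp
  qed
  show "t < ?r" if "b < 1"
  proof (rule ccontr)
    assume n: "\<not> t < ?r"
    have "?r / t * b < ?r / t * 1" using that r t by (intro mult_strict_left_mono) auto
    moreover have "?r / t \<le> 1" using n t by simp
    ultimately show False using * n by simp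
  qed
qed

section \<open>Log-concavity of the critical value\<close>
definition log_rho :: "rule \<Rightarrow> real \<Rightarrow> real \<Rightarrow> real" where
  "log_rho R x u = ln (rho R x (exp u))"

lemma exp_log_rho: "aperiodic R \<Longrightarrow> 0 < x \<Longrightarrow> exp (log_rho R x u) = rho R x (exp u)"
  by (simp add: log_rho_def rho_pos)

definition log_weight :: "real \<Rightarrow> real \<Rightarrow> real \<Rightarrow> step list \<Rightarrow> real" where
  "log_weight x s u w =
     real (length w) * s + of_int (fst (endpoint w)) * ln x + of_int (snd (endpoint w)) * u"

lemma weight_exp:
  assumes "0 < x"
  shows "weight (exp s) x (exp u) = (\<lambda>w. exp (log_weight x s u w))"
proof
  fix w
  have pw: "z powi k = exp (of_int k * ln z)" if "0 < z" for z :: real and k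
    using that by (metis exp_ln exp_power_int)
  show "weight (exp s) x (exp u) w = exp (log_weight x s u w)"
    using assms by (simp add: weight_def log_weight_def pw exp_add exp_of_nat_mult)
qed

lemma B_walks_log_rho:
  assumes "aperiodic R" "0 < x"
  shows "((\<lambda>w. exp (log_weight x (log_rho R x u) u w)) has_sum 1) (B_walks R \<theta>)"
  using B_walks_rho[OF assms exp_gt_zero]
  by (simp only: weight_exp[OF assms(2), symmetric] exp_log_rho[OF assms])

lemma log_rho_sandwich:
  assumes "aperiodic R" "0 < x"
    and "((\<lambda>w. exp (log_weight x s u w)) has_sum b) (B_walks R \<theta>)"
  shows "b \<le> 1 \<Longrightarrow> s \<le> log_rho R x u" and "b < 1 \<Longrightarrow> s < log_rho R x u"
proof -
  have "(weight (exp s) x (exp u) has_sum b) (B_walks R \<theta>)"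
    using assms(3) by (simp only: weight_exp[OF assms(2)])
  note r = rho_sandwich[OF assms(1,2) exp_gt_zero exp_gt_zero this]
  show "s \<le> log_rho R x u" if "b \<le> 1"
    using r(1)[OF that] unfolding exp_log_rho[OF assms(1,2), symmetric] by simp
  show "s < log_rho R x u" if "b < 1"
    using r(2)[OF that] unfolding exp_log_rho[OF assms(1,2), symmetric] by simp
qed

lemma log_weight_affine:
  "log_weight x ((1 - a) * s + a * s') ((1 - a) * u + a * u') w =
    (1 - a) * log_weight x s u w + a * log_weight x s' u' w"
  by (simp add: log_weight_def algebra_simps)

text \<open>
  In logarithmic coordinates the weight of a walk is the exponential of an affine function, so \<open>B\<close> is
  a convex function of \<open>(s, u)\<close>: it is at most 1 at a convex combination of two points where it equals 1.
\<close>
lemma log_rho_concave: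
  assumes "aperiodic R" "0 < x" "0 \<le> a" "a \<le> 1"
  shows "(1 - a) * log_rho R x u + a * log_rho R x v \<le> log_rho R x ((1 - a) * u + a * v)"
proof -
  let ?E = "\<lambda>u w. exp (log_weight x (log_rho R x u) u w)"
  let ?M = "\<lambda>w. exp (log_weight x ((1 - a) * log_rho R x u + a * log_rho R x v) ((1 - a) * u + a * v) w)"
  have "((\<lambda>w. (1 - a) * ?E u w + a * ?E v w) has_sum (1 - a) * 1 + a * 1) (B_walks R South)"
    by (intro has_sum_add has_sum_cmult_right B_walks_log_rho assms)
  moreover have "?M w \<le> (1 - a) * ?E u w + a * ?E v w" for w
    unfolding log_weight_affine using convex_onD[OF exp_convex assms(3,4)] by simp
  ultimately have "\<exists>d\<le>(1 - a) * 1 + a * 1. (?M has_sum d) (B_walks R South)"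
    by (rule has_sum_dominated) (rule exp_ge_zero)
  then obtain d where d: "d \<le> (1 - a) * 1 + a * 1" "(?M has_sum d) (B_walks R South)" by blast
  show ?thesis by (rule log_rho_sandwich(1)[OF assms(1,2) d(2)]) (use d(1) in simp)
qed

lemma convex_on_neg_log_rho:
  assumes "aperiodic R" "0 < x"
  shows "convex_on UNIV (\<lambda>u. - log_rho R x u)"
proof (rule convex_onI)
  fix a u v :: real assume "0 < a" "a < 1"
  then show "- log_rho R x ((1 - a) *\<^sub>R u + a *\<^sub>R v)
      \<le> (1 - a) * - log_rho R x u + a * - log_rho R x v"
    using log_rho_concave[OF assms, of a u v] by simp
qed simp

lemma continuous_log_rho:
  assumes "aperiodic R" "0 < x"
  shows "continuous_on S (log_rho R x)"
proof -
  have "continuous_on UNIV (\<lambda>u. - (- log_rho R x u))"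
    by (intro continuous_on_minus convex_on_continuous[OF open_UNIV convex_on_neg_log_rho[OF assms]])
  then have "continuous_on UNIV (log_rho R x)" by simp
  then show ?thesis by (rule continuous_on_subset) simp
qed

text \<open>
  Cutting at the next occurrence of \<open>\<theta>\<close> turns a repetition of \<open>\<theta>\<close> without \<open>\<eta>\<close> in between into a
  first return to \<open>\<theta>\<close>. For vertical steps this is how failure of north- or south-boundedness is used:
  it yields first returns of net height \<open>-1\<close> and \<open>1\<close>.
\<close>
lemma loop_of_repetition:
  assumes w: "w \<in> walks R" and ij: "i < j" "j < length w" "w ! i = \<theta>" "w ! j = \<theta>"
    and no: "\<not> (\<exists>k. i < k \<and> k < j \<and> w ! k = \<eta>)"
  shows "\<exists>l. l @ [\<theta>] \<in> B_walks R \<theta> \<and> \<theta> \<notin> set l \<and> \<eta> \<notin> set l"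
proof -
  define r where "r = drop (Suc i) w"
  have w_eq: "w = take i w @ \<theta> # r"
    using id_take_nth_drop[of i w] ij by (simp add: r_def)
  have r_nth: "r ! k = w ! (Suc i + k)" if "k < length r" for k
    using that by (simp add: r_def)
  have jr: "j - Suc i < length r" "r ! (j - Suc i) = \<theta>"
    using ij r_nth[of "j - Suc i"] by (auto simp: r_def)
  then have "\<theta> \<in> set r" by (metis nth_mem)
  then obtain l m where lm: "r = l @ \<theta> # m" "\<theta> \<notin> set l" by (auto dest: split_list_first)
  have len: "length l \<le> j - Suc i"
  proof (rule ccontr)
    assume "\<not> ?thesis"
    then have "l ! (j - Suc i) = \<theta>" "j - Suc i < length l"
      using jr lm(1) by (auto simp: nth_append)
    with lm(2) show False by (metis nth_mem)
  qed
  have "\<eta> \<notin> set l"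
  proof
    assume "\<eta> \<in> set l"
    then obtain k where k: "k < length l" "l ! k = \<eta>" by (auto simp: in_set_conv_nth)
    then have "w ! (Suc i + k) = \<eta>" using r_nth[of k] lm(1) by (simp add: nth_append)
    moreover have "i < Suc i + k" "Suc i + k < j" using k(1) len by auto
    ultimately show False using no by blast
  qed
  moreover have "l @ [\<theta>] \<in> B_walks R \<theta>"
  proof -
    have "successively R (take i w @ (\<theta> # (l @ [\<theta>])) @ m)"
      using w w_eq lm(1) by (simp add: walks_def)
    then have s: "successively R (\<theta> # (l @ [\<theta>]))"
      by (simp only: successively_append_iff)
    then have "successively R (l @ [\<theta>])" "R \<theta> (hd (l @ [\<theta>]))"
      by (auto simp: successively_Cons)
    then show ?thesis using lm(2) by (simp add: B_walks_def first_passage_def walks_def count_list_0_iff)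
  qed
  ultimately show ?thesis using lm(2) by blast
qed

lemma height_eq_0: "North \<notin> set l \<Longrightarrow> South \<notin> set l \<Longrightarrow> snd (endpoint l) = 0"
proof (induction l)
  case (Cons s l)
  then show ?case by (cases s) (auto simp: endpoint_def)
qed (simp add: endpoint_def)

lemma descending_loop:
  assumes "\<not> north_bound R"
  shows "\<exists>w\<in>B_walks R South. snd (endpoint w) = -1"
proof -
  obtain w i j where "w \<in> walks R" "i < j" "j < length w" "w ! i = South" "w ! j = South"
    "\<not> (\<exists>k. i < k \<and> k < j \<and> w ! k = North)"
    using assms unfolding north_bound_def by blast
  from loop_of_repetition[OF this] obtain l where
    "l @ [South] \<in> B_walks R South" "South \<notin> set l" "North \<notin> set l" by blast
  then show ?thesis
    using height_eq_0[of l] by (intro bexI[of _ "l @ [South]"]) (simp_all add: endpoint_append, simp add: endpoint_def)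
qed

lemma ascending_loop:
  assumes "\<not> south_bound R"
  shows "\<exists>w\<in>B_walks R North. snd (endpoint w) = 1"
proof -
  obtain w i j where "w \<in> walks R" "i < j" "j < length w" "w ! i = North" "w ! j = North"
    "\<not> (\<exists>k. i < k \<and> k < j \<and> w ! k = South)"
    using assms unfolding south_bound_def by blast
  from loop_of_repetition[OF this] obtain l where
    "l @ [North] \<in> B_walks R North" "North \<notin> set l" "South \<notin> set l" by blast
  then show ?thesis
    using height_eq_0[of l] by (intro bexI[of _ "l @ [North]"]) (simp_all add: endpoint_append, simp add: endpoint_def)
qed

text \<open>
  At the critical value a single term of \<open>B\<close> is at most the whole sum, which is 1.
\<close>
lemma loop_bound:
  assumes "aperiodic R" "0 < x" "w \<in> B_walks R \<theta>"
  shows "log_weight x (log_rho R x u) u w \<le> 0"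
proof -
  have "sum (\<lambda>w. exp (log_weight x (log_rho R x u) u w)) {w} \<le> 1"
    using assms(3) by (intro finite_sum_le_has_sum[OF B_walks_log_rho[OF assms(1,2), of u \<theta>]]) auto
  then show ?thesis by simp
qed

lemma log_rho_below:
  assumes "aperiodic R" "\<not> north_bound R" "0 < x"
  shows "\<exists>K. \<forall>u<K. log_rho R x u < L"
proof -
  obtain w where w: "w \<in> B_walks R South" "snd (endpoint w) = -1"
    using descending_loop[OF assms(2)] by blast
  have len: "0 < length w" using B_walks_nonempty[OF w(1)] by simp
  have "log_rho R x u < L" if "u < real (length w) * L + of_int (fst (endpoint w)) * ln x" for u
  proof -
    have "real (length w) * log_rho R x u < real (length w) * L"
      using that loop_bound[OF assms(1,3) w(1), of u] w(2) by (simp add: log_weight_def)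
    then show ?thesis using len by simp
  qed
  then show ?thesis by blast
qed

lemma log_rho_above:
  assumes "aperiodic R" "\<not> south_bound R" "0 < x"
  shows "\<exists>K. \<forall>u>K. log_rho R x u < L"
proof -
  obtain w where w: "w \<in> B_walks R North" "snd (endpoint w) = 1"
    using ascending_loop[OF assms(2)] by blast
  have len: "0 < length w" using B_walks_nonempty[OF w(1)] by simp
  have "log_rho R x u < L" if "u > - (real (length w) * L) - of_int (fst (endpoint w)) * ln x" for u
  proof -
    have "real (length w) * log_rho R x u < real (length w) * L"
      using that loop_bound[OF assms(1,3) w(1), of u] w(2) by (simp add: log_weight_def)
    then show ?thesis using len by simp
  qed
  then show ?thesis by blast
qed

section \<open>The maximum of the critical value\<close>
lemma log_rho_max:
  assumes "aperiodic R" "vertically_unbounded R" "0 < x"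
  shows "\<exists>u0. \<forall>u. log_rho R x u \<le> log_rho R x u0"
proof -
  have ub: "\<not> north_bound R" "\<not> south_bound R" using assms(2) by (auto simp: vertically_unbounded_def)
  obtain K K' where K: "\<And>u. u < K \<Longrightarrow> log_rho R x u < log_rho R x 0"
    and K': "\<And>u. u > K' \<Longrightarrow> log_rho R x u < log_rho R x 0"
    using log_rho_below[OF assms(1) ub(1) assms(3)] log_rho_above[OF assms(1) ub(2) assms(3)] by metis
  have K0: "K \<le> 0" "0 \<le> K'" using K[of 0] K'[of 0] by force+
  then have "\<exists>u0\<in>{K..K'}. \<forall>u\<in>{K..K'}. log_rho R x u \<le> log_rho R x u0"
    by (intro continuous_attains_sup continuous_log_rho assms) auto
  then obtain u0 where u0: "\<And>u. u \<in> {K..K'} \<Longrightarrow> log_rho R x u \<le> log_rho R x u0" by blast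
  have "log_rho R x u \<le> log_rho R x u0" for u
  proof (cases "u \<in> {K..K'}")
    case False
    then have "log_rho R x u < log_rho R x 0" using K K' by force
    also have "\<dots> \<le> log_rho R x u0" using u0 K0 by simp
    finally show ?thesis by simp
  qed (rule u0)
  then show ?thesis by blast
qed

text \<open>
  Between two maximisers the concave function would be constant, but at the midpoint \<open>B\<close> is strictly
  smaller than 1, because the weight of a descending loop really depends on \<open>u\<close>.
\<close>
lemma log_rho_max_unique:
  assumes "aperiodic R" "\<not> north_bound R" "0 < x"
    and u: "\<And>z. log_rho R x z \<le> log_rho R x u" and v: "\<And>z. log_rho R x z \<le> log_rho R x v"
  shows "u = v"
proof (rule ccontr)
  assume "u \<noteq> v"
  define s where "s = log_rho R x u"
  have s: "log_rho R x u = s" "log_rho R x v = s" using u v by (auto simp: s_def intro: order_antisym)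
  let ?E = "\<lambda>u w. exp (log_weight x s u w)"
  have avg: "((\<lambda>w. 1 / 2 * ?E u w + 1 / 2 * ?E v w) has_sum 1 / 2 * 1 + 1 / 2 * 1) (B_walks R South)"
    using B_walks_log_rho[OF assms(1,3), of u] B_walks_log_rho[OF assms(1,3), of v] unfolding s
    by (intro has_sum_add has_sum_cmult_right)
  have mid: "?E ((u + v) / 2) w = exp ((log_weight x s u w + log_weight x s v w) / 2)" for w
    by (simp add: log_weight_def field_simps)
  have gap: "(1 / 2 * exp a + 1 / 2 * exp b) - exp ((a + b) / 2) = (exp (a / 2) - exp (b / 2))\<^sup>2 / 2" for a b :: real
    by (simp add: power2_eq_square field_simps exp_add[symmetric])
  have le: "?E ((u + v) / 2) w \<le> 1 / 2 * ?E u w + 1 / 2 * ?E v w" for w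
    unfolding mid using gap[of "log_weight x s u w" "log_weight x s v w"] zero_le_power2
    by (smt (verit) divide_nonneg_nonneg)
  obtain w0 where w0: "w0 \<in> B_walks R South" "snd (endpoint w0) = -1"
    using descending_loop[OF assms(2)] by blast
  have "?E ((u + v) / 2) w0 < 1 / 2 * ?E u w0 + 1 / 2 * ?E v w0"
  proof -
    have "log_weight x s u w0 \<noteq> log_weight x s v w0" using \<open>u \<noteq> v\<close> w0(2) by (simp add: log_weight_def)
    then have "0 < (exp (log_weight x s u w0 / 2) - exp (log_weight x s v w0 / 2))\<^sup>2 / 2" by simp
    then show ?thesis unfolding mid using gap[of "log_weight x s u w0" "log_weight x s v w0"] by linarith
  qed
  then obtain d where d: "d < 1 / 2 * 1 + 1 / 2 * 1" "(?E ((u + v) / 2) has_sum d) (B_walks R South)"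
    using has_sum_dominated_less[OF avg le exp_ge_zero w0(1)] by blast
  have "s < log_rho R x ((u + v) / 2)" using d by (intro log_rho_sandwich(2)[OF assms(1,3) d(2)]) simp
  with u[of "(u + v) / 2"] show False by (simp add: s_def)
qed

text \<open>
  That is, \<open>(cosh z - 1) / z\<^sup>2\<close> increases in \<open>\<bar>z\<bar>\<close>; since \<open>cosh z - 1 = 2 sinh\<^sup>2 (z / 2)\<close> this follows from
  the convexity of \<open>sinh\<close> on the positive half-line. It controls second differences of \<open>B\<close> at small
  distances by the one at a fixed distance, term by term.
\<close>
lemma cosh_quadratic_scaling:
  fixes a z :: real
  assumes a: "0 \<le> a" "a \<le> 1"
  shows "exp (a * z) + exp (- (a * z)) - 2 \<le> a\<^sup>2 * (exp z + exp (- z) - 2)"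
proof -
  have cv: "convex_on {0..} (sinh :: real \<Rightarrow> real)"
    by (rule convex_on_realI[where f' = cosh])
      (auto intro!: derivative_eq_intros simp: cosh_real_nonneg_le_iff)
  have sinh_le: "sinh (a * v) \<le> a * sinh v" if "0 \<le> v" for v :: real
    using convex_onD[OF cv a, of 0 v] that by simp
  have sq: "exp z + exp (- z) - 2 = 4 * (sinh (\<bar>z\<bar> / 2))\<^sup>2" for z :: real
  proof -
    have "(sinh (\<bar>z\<bar> / 2))\<^sup>2 = (sinh (z / 2))\<^sup>2" by (cases "0 \<le> z") (simp_all add: abs_if)
    moreover have "4 * (sinh (z / 2))\<^sup>2 = (exp (z / 2) - exp (- (z / 2)))\<^sup>2"
      by (simp add: sinh_def power2_eq_square)
    moreover have "\<dots> = exp z + exp (- z) - 2"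
      by (simp add: power2_diff exp_double[symmetric] exp_minus_inverse)
    ultimately show ?thesis by simp
  qed
  have "(sinh (\<bar>a * z\<bar> / 2))\<^sup>2 \<le> (a * sinh (\<bar>z\<bar> / 2))\<^sup>2"
    using sinh_le[of "\<bar>z\<bar> / 2"] a by (intro power_mono) (simp_all add: abs_mult)
  then show ?thesis unfolding sq by (simp add: power_mult_distrib)
qed

lemma weight_height_shift:
  assumes "0 < y"
  shows "weight t x (y * exp z) w = weight t x y w * exp (of_int (snd (endpoint w)) * z)"
proof -
  have "(y * exp z) powi k = y powi k * exp (of_int k * z)" for k :: int
    by (simp add: power_int_mult_distrib exp_power_int)
  then show ?thesis by (simp add: weight_def)
qed

lemma step_height: "\<bar>snd (endpoint [j])\<bar> \<le> 1"
  by (cases j) (auto simp: endpoint_def)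

text \<open>
  A step changes the height by at most 1, so replacing \<open>y\<close> by \<open>y * exp z\<close> multiplies its weight by at
  most \<open>exp \<bar>z\<bar>\<close>, and the strict supersolution at \<open>y\<close> survives for small \<open>z\<close>.
\<close>
lemma summable_near_rho:
  assumes ap: "aperiodic R" and xy: "0 < x" "0 < y"
  shows "\<exists>\<delta>>0. \<forall>z. \<bar>z\<bar> \<le> \<delta> \<longrightarrow>
    weight (rho R x y) x (y * exp z) summable_on B_walks R \<theta>"
proof -
  define r where "r = rho R x y"
  obtain h where h: "harmonic R r x y h" using rho_harmonic[OF assms] by (auto simp: r_def)
  have r: "0 < r" unfolding r_def by (rule rho_pos[OF assms])
  obtain g q where q: "0 \<le> q" "q < 1" and gpos: "\<And>i. 0 < g i"
    and g: "\<And>i. (\<Sum>j | R i j \<and> j \<noteq> \<theta>. weight r x y [j] * g j) \<le> q * g i"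
    using killed_supersolution[OF ap h xy, of \<theta>] by blast
  \<comment> \<open>The choice makes \<open>exp \<delta> * q = 2 * q / (1 + q)\<close>, which is below 1.\<close>
  define \<delta> where "\<delta> = ln (2 / (1 + q))"
  have "0 < \<delta>" unfolding \<delta>_def using q by simp
  moreover have "weight r x (y * exp z) summable_on B_walks R \<theta>" if z: "\<bar>z\<bar> \<le> \<delta>" for z
    unfolding B_walks_stopped
  proof (rule first_passage_summable[OF r xy(1) _ _ gpos])
    show "0 < y * exp z" using xy by simp
    show "exp \<delta> * q < 1" using q by (simp add: \<delta>_def)
    fix i
    have le: "weight r x (y * exp z) [j] \<le> exp \<delta> * weight r x y [j]" for j
    proof -
      have "of_int (snd (endpoint [j])) * z \<le> \<bar>of_int (snd (endpoint [j]))\<bar> * \<bar>z\<bar>"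
        by (metis abs_ge_self abs_mult)
      also have "\<dots> \<le> 1 * \<bar>z\<bar>"
        using step_height[of j] by (intro mult_right_mono) auto
      also have "\<dots> \<le> \<delta>" using z by simp
      finally have "exp (of_int (snd (endpoint [j])) * z) \<le> exp \<delta>" by simp
      then show ?thesis
        unfolding weight_height_shift[OF xy(2)] mult.commute[of "exp \<delta>"]
        using weight_pos[OF r xy, of "[j]"] by (intro mult_left_mono) auto
    qed
    have "(\<Sum>j | R i j \<and> j \<noteq> \<theta>. weight r x (y * exp z) [j] * g j) \<le>
        (\<Sum>j | R i j \<and> j \<noteq> \<theta>. exp \<delta> * weight r x y [j] * g j)"
      by (intro sum_mono mult_right_mono le less_imp_le gpos)
    also have "\<dots> = exp \<delta> * (\<Sum>j | R i j \<and> j \<noteq> \<theta>. weight r x y [j] * g j)"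
      by (simp add: sum_distrib_left mult.assoc)
    also have "\<dots> \<le> exp \<delta> * (q * g i)" by (intro mult_left_mono g) simp
    finally show "(\<Sum>j | R i j \<and> j \<noteq> \<theta>. weight r x (y * exp z) [j] * g j) \<le> exp \<delta> * q * g i"
      by (simp only: mult.assoc)
  qed
  ultimately show ?thesis unfolding r_def by blast
qed

text \<open>
  Fix \<open>r = rho R x y\<close> and let \<open>F z\<close> be the value of \<open>B\<close> at \<open>(r, y * exp z)\<close>. Maximality of \<open>r\<close> means
  \<open>F \<ge> 1\<close>, and \<open>F z + F (- z) - 2\<close> is of order \<open>z\<^sup>2\<close>, so \<open>F z \<le> 1 + K z\<^sup>2\<close>. Dividing \<open>r\<close> by \<open>1 + K z\<^sup>2\<close> then
  brings \<open>B\<close> down to at most 1.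
\<close>
lemma rho_quadratic_lower_bound:
  assumes ap: "aperiodic R" and xy: "0 < x" "0 < y"
    and max: "\<And>y'. 0 < y' \<Longrightarrow> rho R x y' \<le> rho R x y"
  shows "\<exists>\<delta>>0. \<exists>K\<ge>0. \<forall>z. \<bar>z\<bar> \<le> \<delta> \<longrightarrow> rho R x y \<le> (1 + K * z\<^sup>2) * rho R x (y * exp z)"
proof -
  define r where "r = rho R x y"
  have r: "0 < r" unfolding r_def by (rule rho_pos[OF ap xy])
  obtain \<delta> where \<delta>: "0 < \<delta>"
    and summable: "\<And>z. \<bar>z\<bar> \<le> \<delta> \<Longrightarrow> weight r x (y * exp z) summable_on B_walks R North"
    using summable_near_rho[OF ap xy, of North] unfolding r_def by blast
  define F where "F z = gf (B_walks R North) r x (y * exp z)" for z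
  have F: "(weight r x (y * exp z) has_sum F z) (B_walks R North)" if "\<bar>z\<bar> \<le> \<delta>" for z
    unfolding F_def gf_def by (rule has_sum_infsum[OF summable[OF that]])
  have F_ge: "1 \<le> F z" if "\<bar>z\<bar> \<le> \<delta>" for z
  proof (rule ccontr)
    assume "\<not> 1 \<le> F z"
    then have "r < rho R x (y * exp z)"
      by (intro rho_sandwich(2)[OF ap xy(1) _ r F[OF that]]) (use xy in auto)
    with max[of "y * exp z"] xy show False by (simp add: r_def)
  qed
  define K where "K = (F \<delta> + F (- \<delta>) - 2) / \<delta>\<^sup>2"
  have K: "0 \<le> K" unfolding K_def using F_ge[of \<delta>] F_ge[of "- \<delta>"] \<delta> by simp
  have F_le: "F z \<le> 1 + K * z\<^sup>2" if z: "\<bar>z\<bar> \<le> \<delta>" for z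
  proof -
    define a where "a = \<bar>z\<bar> / \<delta>"
    have a: "0 \<le> a" "a \<le> 1" using z \<delta> by (auto simp: a_def)
    have sym: "((\<lambda>w. weight r x (y * exp z) w + weight r x (y * exp (- z)) w - 2 * weight r x y w)
        has_sum F z + F (- z) - 2 * 1) (B_walks R North)" if "\<bar>z\<bar> \<le> \<delta>" for z
    proof -
      have "(weight r x y has_sum 1) (B_walks R North)" unfolding r_def by (rule B_walks_rho[OF ap xy])
      then have "((\<lambda>w. (weight r x (y * exp z) w + weight r x (y * exp (- z)) w) + (- 2) * weight r x y w)
          has_sum (F z + F (- z)) + (- 2) * 1) (B_walks R North)"
        using that by (intro has_sum_add has_sum_cmult_right F) auto
      then show ?thesis by simp
    qed
    have "F z + F (- z) - 2 * 1 \<le> a\<^sup>2 * (F \<delta> + F (- \<delta>) - 2 * 1)"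
    proof (rule has_sum_mono[OF sym[OF z]])
      show "((\<lambda>w. a\<^sup>2 * (weight r x (y * exp \<delta>) w + weight r x (y * exp (- \<delta>)) w - 2 * weight r x y w))
          has_sum a\<^sup>2 * (F \<delta> + F (- \<delta>) - 2 * 1)) (B_walks R North)"
        by (intro has_sum_cmult_right sym) (use \<delta> in simp)
      fix w
      define b :: real where "b = of_int (snd (endpoint w))"
      have "exp (b * z) + exp (b * (- z)) = exp (a * (b * \<delta>)) + exp (- (a * (b * \<delta>)))"
        using \<delta> by (cases "0 \<le> z") (simp_all add: a_def mult.commute)
      then have e: "exp (b * z) + exp (b * (- z)) - 2 \<le> a\<^sup>2 * (exp (b * \<delta>) + exp (b * (- \<delta>)) - 2)"
        using cosh_quadratic_scaling[OF a, of "b * \<delta>"] by simp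
      have "weight r x y w * (exp (b * z) + exp (b * (- z)) - 2) \<le>
          weight r x y w * (a\<^sup>2 * (exp (b * \<delta>) + exp (b * (- \<delta>)) - 2))"
        by (rule mult_left_mono[OF e less_imp_le[OF weight_pos[OF r xy]]])
      then show "weight r x (y * exp z) w + weight r x (y * exp (- z)) w - 2 * weight r x y w \<le>
          a\<^sup>2 * (weight r x (y * exp \<delta>) w + weight r x (y * exp (- \<delta>)) w - 2 * weight r x y w)"
        unfolding weight_height_shift[OF xy(2)] b_def[symmetric] by (simp add: algebra_simps)
    qed
    moreover have "1 \<le> F (- z)" using z by (intro F_ge) simp
    moreover have "a\<^sup>2 * (F \<delta> + F (- \<delta>) - 2 * 1) = K * z\<^sup>2"
      by (simp add: a_def K_def power_divide)
    ultimately show ?thesis by simp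
  qed
  have "r \<le> (1 + K * z\<^sup>2) * rho R x (y * exp z)" if z: "\<bar>z\<bar> \<le> \<delta>" for z
  proof -
    define c where "c = 1 + K * z\<^sup>2"
    have c: "1 \<le> c" unfolding c_def using K by simp
    have y': "0 < y * exp z" using xy by simp
    obtain d where d: "d \<le> r / c / r * F z" "(weight (r / c) x (y * exp z) has_sum d) (B_walks R North)"
      using B_walks_shrink[OF F[OF z], of "r / c"] c r xy by (auto simp: divide_le_eq)
    have "d \<le> 1"
    proof -
      have "r / c / r * F z \<le> r / c / r * c"
        using F_le[OF z] c r unfolding c_def[symmetric] by (intro mult_left_mono) auto
      also have "\<dots> = 1" using c r by simp
      finally show ?thesis using d(1) by simp
    qed
    then have "r / c \<le> rho R x (y * exp z)"
      using c r by (intro rho_sandwich(1)[OF ap xy(1) y' _ d(2)]) auto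
    then show ?thesis using c by (simp add: c_def[symmetric] divide_le_eq mult.commute)
  qed
  with \<delta> K show ?thesis unfolding r_def by blast
qed

lemma rho_critical_at_max:
  assumes ap: "aperiodic R" and xy: "0 < x" "0 < y"
    and max: "\<And>y'. 0 < y' \<Longrightarrow> rho R x y' \<le> rho R x y"
  shows "(rho R x has_real_derivative 0) (at y)"
proof -
  define G where "G u = rho R x (exp u)" for u
  define r where "r = rho R x y"
  have G0: "G (ln y) = r" using xy by (simp add: G_def r_def)
  have r: "0 < r" unfolding r_def by (rule rho_pos[OF ap xy])
  obtain \<delta> K where \<delta>: "0 < \<delta>" and K: "0 \<le> K"
    and low: "\<And>z. \<bar>z\<bar> \<le> \<delta> \<Longrightarrow> r \<le> (1 + K * z\<^sup>2) * rho R x (y * exp z)"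
    using rho_quadratic_lower_bound[OF ap xy max] unfolding r_def by blast
  have Gz: "G (ln y + z) = rho R x (y * exp z)" for z
    using xy by (simp add: G_def exp_add)
  have bound: "norm ((G (ln y + z) - G (ln y)) / z) \<le> K * r * \<bar>z\<bar>" if z: "\<bar>z\<bar> \<le> \<delta>" for z
  proof (cases "z = 0")
    case False
    have up: "G (ln y + z) \<le> r" unfolding Gz r_def using xy by (intro max) simp
    have "r - G (ln y + z) \<le> K * z\<^sup>2 * G (ln y + z)"
      using low[OF z] unfolding Gz by (simp add: algebra_simps)
    also have "\<dots> \<le> K * z\<^sup>2 * r" using K up by (intro mult_left_mono) auto
    finally have "\<bar>G (ln y + z) - G (ln y)\<bar> \<le> (K * r * \<bar>z\<bar>) * \<bar>z\<bar>"
      using up by (simp add: G0 power2_eq_square abs_if algebra_simps split: if_splits)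
    then show ?thesis using False by (simp add: divide_le_eq)
  qed simp
  have "((\<lambda>z. (G (ln y + z) - G (ln y)) / z) \<longlongrightarrow> 0) (at 0)"
  proof (rule Lim_null_comparison)
    show "\<forall>\<^sub>F z in at 0. norm ((G (ln y + z) - G (ln y)) / z) \<le> K * r * \<bar>z\<bar>"
      unfolding eventually_at using \<delta> bound by (intro exI[of _ \<delta>]) auto
    show "((\<lambda>z. K * r * \<bar>z\<bar>) \<longlongrightarrow> 0) (at 0)"
      by (intro tendsto_eq_intros) auto
  qed
  then have "(G has_real_derivative 0) (at (ln y))" by (simp add: DERIV_def)
  from DERIV_chain2[OF this DERIV_ln[OF xy(2)]]
  have "((\<lambda>y. G (ln y)) has_real_derivative 0) (at y)" by simp
  then show ?thesis
    by (rule has_field_derivative_transform_within_open[of _ _ _ "{0<..}"])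
      (use xy in \<open>auto simp: G_def\<close>)
qed

text \<open>
  A concave function lies below its tangents, and here the tangent is horizontal.
\<close>
lemma log_rho_max_of_critical:
  assumes ap: "aperiodic R" and x: "0 < x"
    and deriv: "(rho R x has_real_derivative 0) (at (exp u))"
  shows "log_rho R x v \<le> log_rho R x u"
proof -
  have "((\<lambda>u. rho R x (exp u)) has_real_derivative 0 * exp u) (at u)"
    using deriv by (intro DERIV_chain2[where g = exp] DERIV_exp)
  from DERIV_chain2[OF DERIV_ln[OF rho_pos[OF ap x exp_gt_zero]] this]
  have "(log_rho R x has_real_derivative 0) (at u)"
    by (simp add: log_rho_def[abs_def])
  then have "((\<lambda>u. - log_rho R x u) has_real_derivative - 0) (at u)" by (rule DERIV_minus)
  then have "- log_rho R x v - - log_rho R x u \<ge> - 0 * (v - u)"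
    by (intro convex_on_imp_above_tangent[OF convex_on_neg_log_rho[OF ap x]]) auto
  then show ?thesis by simp
qed

text \<open>
  The maximiser is the only critical point, so the definite description in the definition of \<open>tau\<close>
  denotes it.
\<close>
lemma tau_max:
  assumes ap: "aperiodic R" and vu: "vertically_unbounded R" and x: "0 < x"
  shows "0 < tau R x" and "\<And>u. log_rho R x u \<le> log_rho R x (ln (tau R x))"
proof -
  have nb: "\<not> north_bound R" using vu by (simp add: vertically_unbounded_def)
  obtain u0 where u0: "\<And>u. log_rho R x u \<le> log_rho R x u0" using log_rho_max[OF assms] by blast
  have rho_max: "rho R x y' \<le> rho R x (exp u0)" if "0 < y'" for y'
  proof -
    have "exp (log_rho R x (ln y')) \<le> exp (log_rho R x u0)" using u0 by simp
    then show ?thesis using that by (simp add: exp_log_rho[OF ap x])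
  qed
  have "tau R x = exp u0"
    unfolding tau_def
  proof (rule the_equality)
    show "0 < exp u0 \<and> (rho R x has_real_derivative 0) (at (exp u0))"
      by (intro conjI exp_gt_zero rho_critical_at_max ap x rho_max)
    fix y assume y: "0 < y \<and> (rho R x has_real_derivative 0) (at y)"
    then have "log_rho R x v \<le> log_rho R x (ln y)" for v
      by (intro log_rho_max_of_critical ap x) simp
    then have "ln y = u0" by (rule log_rho_max_unique[OF ap nb x _ u0])
    then show "y = exp u0" using y by auto
  qed
  then show "0 < tau R x" "\<And>u. log_rho R x u \<le> log_rho R x (ln (tau R x))" using u0 by auto
qed

text \<open>
  Left of the maximum, \<open>log_rho\<close> is injective, since by concavity a tie there would produce a second
  maximiser, and it takes all values below the maximum, since it is continuous and
  tends to minus infinity.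
\<close>
lemma upsilon_minus_props:
  assumes ap: "aperiodic R" and vu: "vertically_unbounded R" and x: "0 < x"
    and t: "0 < t" "t < kappa R x"
  shows "0 < upsilon_minus R t x" "upsilon_minus R t x < tau R x" "rho R x (upsilon_minus R t x) = t"
proof -
  have nb: "\<not> north_bound R" using vu by (simp add: vertically_unbounded_def)
  define u0 where "u0 = ln (tau R x)"
  have tau: "tau R x = exp u0" using tau_max(1)[OF ap vu x] by (simp add: u0_def)
  have u0: "log_rho R x u \<le> log_rho R x u0" for u unfolding u0_def by (rule tau_max(2)[OF ap vu x])
  have rho_inj: "rho R x (exp u) = rho R x (exp v) \<longleftrightarrow> log_rho R x u = log_rho R x v" for u v
    using exp_log_rho[OF ap x] by (metis log_rho_def)
  have no_tie: False if uv: "u < v" "v < u0" and eq: "log_rho R x u = log_rho R x v" for u v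
  proof -
    define a where "a = (v - u) / (u0 - u)"
    have a: "0 < a" "a \<le> 1" using uv by (auto simp: a_def)
    have "a * (u0 - u) = v - u" using uv by (simp add: a_def)
    then have "v = (1 - a) * u + a * u0" by (simp add: algebra_simps)
    then have "(1 - a) * log_rho R x u + a * log_rho R x u0 \<le> log_rho R x u"
      using log_rho_concave[OF ap x, of a u u0] a eq by simp
    then have "a * log_rho R x u0 \<le> a * log_rho R x u" by (simp add: algebra_simps)
    then have le: "log_rho R x u0 \<le> log_rho R x u" using a by simp
    have "log_rho R x z \<le> log_rho R x u" for z using u0[of z] le by linarith
    then have "u = u0" by (rule log_rho_max_unique[OF ap nb x _ u0])
    with uv show False by simp
  qed
  have inj: "inj_on (rho R x) {0<..<tau R x}"
  proof (rule inj_onI)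
    fix y z assume yz: "y \<in> {0<..<tau R x}" "z \<in> {0<..<tau R x}" "rho R x y = rho R x z"
    then have lt: "ln y < u0" "ln z < u0" using tau_max(1)[OF ap vu x] by (auto simp: u0_def)
    have eq: "log_rho R x (ln y) = log_rho R x (ln z)"
      using yz by (simp add: log_rho_def)
    have "ln y = ln z"
      using no_tie[of "ln y" "ln z"] no_tie[of "ln z" "ln y"] lt eq by force
    then show "y = z" using yz by simp
  qed
  have "kappa R x = exp (log_rho R x u0)" by (simp add: kappa_def tau exp_log_rho[OF ap x])
  then have ltop: "ln t < log_rho R x u0" using t by (metis exp_less_cancel_iff exp_ln)
  obtain K where K: "\<And>u. u < K \<Longrightarrow> log_rho R x u < ln t" using log_rho_below[OF ap nb x] by blast
  define u1 where "u1 = min (K - 1) u0"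
  have "log_rho R x u1 \<le> ln t"
  proof -
    have "K - 1 < K" by simp
    then have "u1 < K" by (simp add: u1_def)
    then show ?thesis using K by (simp add: less_imp_le)
  qed
  moreover have "u1 \<le> u0" by (simp add: u1_def)
  ultimately obtain u where u: "u \<le> u0" "log_rho R x u = ln t"
    using IVT'[OF _ less_imp_le[OF ltop] _ continuous_log_rho[OF ap x]] by blast
  have "u \<noteq> u0" using u(2) ltop by auto
  then have y: "exp u \<in> {0<..<tau R x}" using u(1) by (simp add: tau)
  have "rho R x (exp u) = t" using exp_log_rho[OF ap x, of u] u(2) t by simp
  then have "upsilon_minus R t x = exp u"
    unfolding upsilon_minus_def using y by (intro the_inv_into_f_eq inj)
  then show "0 < upsilon_minus R t x" "upsilon_minus R t x < tau R x" "rho R x (upsilon_minus R t x) = t"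
    using y \<open>rho R x (exp u) = t\<close> by auto
qed

section \<open>Walks in the half-plane\<close>
definition above_axis :: "step list \<Rightarrow> bool" where
  "above_axis w \<longleftrightarrow> 0 \<le> snd (endpoint w)"

lemma all_above_axis_iff:
  "(\<forall>u. u \<noteq> [] \<and> prefix u w \<longrightarrow> above_axis u) \<longleftrightarrow> (\<forall>k\<le>length w. 0 \<le> snd (endpoint (take k w)))"
proof
  assume *: "\<forall>u. u \<noteq> [] \<and> prefix u w \<longrightarrow> above_axis u"
  show "\<forall>k\<le>length w. 0 \<le> snd (endpoint (take k w))"
  proof (intro allI impI)
    fix k
    show "0 \<le> snd (endpoint (take k w))"
      using *[rule_format, of "take k w"] by (cases "take k w = []") (auto simp: above_axis_def endpoint_def take_is_prefix)
  qed
next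
  assume *: "\<forall>k\<le>length w. 0 \<le> snd (endpoint (take k w))"
  show "\<forall>u. u \<noteq> [] \<and> prefix u w \<longrightarrow> above_axis u"
  proof (intro allI impI)
    fix u assume "u \<noteq> [] \<and> prefix u w"
    then obtain v where "w = u @ v" by (auto simp: prefix_def)
    then show "above_axis u" using *[rule_format, of "length u"] by (simp add: above_axis_def)
  qed
qed

lemma H_walks_iff:
  "w \<in> H_walks R \<phi> \<longleftrightarrow> w \<in> walks R \<and> last w = \<phi> \<and> (\<forall>u. u \<noteq> [] \<and> prefix u w \<longrightarrow> above_axis u)"
  unfolding all_above_axis_iff H_walks_def by blast

lemma snd_endpoint_snoc: "snd (endpoint (u @ [j])) = snd (endpoint u) + snd (step_vec j)"
  by (simp add: endpoint_def)

text \<open>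
  The walks counted by \<open>H_star\<close> at \<open>y = 0\<close>: those from which one further, permitted step leaves the
  half-plane.
\<close>
definition ready_to_exit :: "rule \<Rightarrow> step list set" where
  "ready_to_exit R = {u \<in> (\<Union>\<phi>\<in>{\<phi>. R \<phi> South}. H_walks R \<phi>). snd (endpoint u) = 0}"

text \<open>
  A walk can leave the half-plane only by a south step from height 0; the walk consisting of a single
  south step leaves it at once.
\<close>
lemma half_plane_exits:
  "stopped R UNIV above_axis = insert [South] ((\<lambda>u. u @ [South]) ` ready_to_exit R)"
proof (rule set_eqI)
  fix w
  show "w \<in> stopped R UNIV above_axis \<longleftrightarrow>
      w \<in> insert [South] ((\<lambda>u. u @ [South]) ` ready_to_exit R)"
  proof (cases w rule: rev_cases)
    case Nil
    then show ?thesis by (auto simp: stopped_def walks_def)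
  next
    case (snoc u j)
    show ?thesis
    proof (cases "u = []")
      case True
      then have "w \<in> stopped R UNIV above_axis \<longleftrightarrow> j = South"
        using snoc by (cases j) (auto simp: stopped_def walks_def above_axis_def endpoint_def strict_prefix_def prefix_Cons)
      moreover have "[] \<notin> ready_to_exit R" by (auto simp: ready_to_exit_def H_walks_def walks_def)
      ultimately show ?thesis using snoc True by auto
    next
      case False
      have "w \<in> stopped R UNIV above_axis \<longleftrightarrow> u \<in> walks R \<and> R (last u) j \<and>
          (\<forall>v. v \<noteq> [] \<and> prefix v u \<longrightarrow> above_axis v) \<and> \<not> above_axis (u @ [j])"
        unfolding stopped_def snoc using False by (auto simp: walks_snoc strict_prefix_snoc)
      also have "\<dots> \<longleftrightarrow> u \<in> walks R \<and> R (last u) j \<and>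
          (\<forall>v. v \<noteq> [] \<and> prefix v u \<longrightarrow> above_axis v) \<and> j = South \<and> snd (endpoint u) = 0"
      proof -
        have "\<not> above_axis (u @ [j]) \<longleftrightarrow> j = South \<and> snd (endpoint u) = 0" if "above_axis u"
          using that unfolding above_axis_def snd_endpoint_snoc by (cases j) auto
        then show ?thesis using False by blast
      qed
      also have "\<dots> \<longleftrightarrow> u \<in> ready_to_exit R \<and> j = South"
        unfolding ready_to_exit_def by (auto simp: H_walks_iff)
      finally show ?thesis using snoc False by auto
    qed
  qed
qed

text \<open>
  This is where the branch left of the maximum matters. Above the axis \<open>y ^ b \<le> y' ^ b\<close>, so the walks
  may be weighted with \<open>y'\<close> instead, and since \<open>t\<close> is subcritical there their total weight decays like
  \<open>(t / rho R x y') ^ n\<close>.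
\<close>
lemma half_plane_decay:
  assumes ap: "aperiodic R" and x: "0 < x" and y: "0 < y" "y < y'" and t: "0 < t" "t < rho R x y'"
    and h: "\<And>i. 0 < h i"
  shows "(\<lambda>n. \<Sum>w\<in>surviving R UNIV above_axis (Suc n). weight t x y w * h (last w)) \<longlonglongrightarrow> 0"
proof -
  define r where "r = rho R x y'"
  have y': "0 < y'" using y by simp
  have r: "0 < r" unfolding r_def by (rule rho_pos[OF ap x y'])
  obtain h' where h': "harmonic R r x y' h'" using rho_harmonic[OF ap x y'] by (auto simp: r_def)
  have h'pos: "0 < h' i" for i using h' by (simp add: harmonic_def)
  define K where "K = Max (range (\<lambda>i. h i / h' i))"
  have K: "h i \<le> K * h' i" for i
  proof -
    have "h i / h' i \<le> K" unfolding K_def by (intro Max_ge) auto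
    then show ?thesis using h'pos[of i] by (simp add: pos_divide_le_eq)
  qed
  have K0: "0 \<le> K" using K[of East] h[of East] h'pos[of East] by (smt (verit) mult_neg_pos)
  define C where "C = (\<Sum>j\<in>UNIV. weight r x y' [j] * h' j)"
  let ?A = "\<lambda>n. surviving R UNIV above_axis (Suc n)"
  have le: "weight t x y w * h (last w) \<le> K * (t / r) ^ Suc n * (weight r x y' w * h' (last w))"
    if w: "w \<in> ?A n" for w n
  proof -
    have len: "length w = Suc n" using w by (simp add: surviving_def)
    have "above_axis w" using w by (auto simp: surviving_def walks_def)
    then obtain b where b: "snd (endpoint w) = int b" unfolding above_axis_def by (rule nonneg_int_cases)
    have "y ^ b \<le> y' ^ b" using y by (intro power_mono) auto
    then have "weight t x y w \<le> t ^ length w * x powi fst (endpoint w) * y' powi snd (endpoint w)"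
      unfolding weight_def b using t x by (intro mult_left_mono) auto
    also have "\<dots> = (t / r) ^ Suc n * weight r x y' w"
      using r by (simp add: weight_def len power_divide)
    finally have "weight t x y w * h (last w) \<le> ((t / r) ^ Suc n * weight r x y' w) * (K * h' (last w))"
      using t r weight_pos[OF r x y', of w] h[of "last w"] by (intro mult_mono K) (auto simp: less_imp_le)
    then show ?thesis by (simp add: ac_simps)
  qed
  have bound: "(\<Sum>w\<in>?A n. weight t x y w * h (last w)) \<le> K * (t / r) ^ Suc n * C" for n
  proof -
    have sub: "?A n \<subseteq> surviving R UNIV (\<lambda>_. True) (Suc n)" by (auto simp: surviving_def)
    have "(\<Sum>w\<in>?A n. weight t x y w * h (last w)) \<le>
        (\<Sum>w\<in>?A n. K * (t / r) ^ Suc n * (weight r x y' w * h' (last w)))"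
      by (intro sum_mono le)
    also have "\<dots> = K * (t / r) ^ Suc n * (\<Sum>w\<in>?A n. weight r x y' w * h' (last w))"
      by (simp only: sum_distrib_left)
    also have "\<dots> \<le> K * (t / r) ^ Suc n * C"
    proof (rule mult_left_mono)
      have "(\<Sum>w\<in>?A n. weight r x y' w * h' (last w)) \<le>
          (\<Sum>w\<in>surviving R UNIV (\<lambda>_. True) (Suc n). weight r x y' w * h' (last w))"
        using mult_pos_pos[OF weight_pos[OF r x y'] h'pos]
        by (intro sum_mono2 finite_surviving sub) (auto simp: less_imp_le)
      also have "\<dots> = C" unfolding C_def by (rule all_walks_mass[OF h' x y'])
      finally show "(\<Sum>w\<in>?A n. weight r x y' w * h' (last w)) \<le> C" .
      show "0 \<le> K * (t / r) ^ Suc n" using K0 t r by (intro mult_nonneg_nonneg zero_le_power) auto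
    qed
    finally show ?thesis .
  qed
  show ?thesis
  proof (rule tendsto_sandwich)
    show "\<forall>\<^sub>F n in sequentially. 0 \<le> (\<Sum>w\<in>?A n. weight t x y w * h (last w))"
      by (intro always_eventually allI sum_nonneg mult_nonneg_nonneg less_imp_le weight_pos t x y h)
    show "\<forall>\<^sub>F n in sequentially. (\<Sum>w\<in>?A n. weight t x y w * h (last w)) \<le> K * (t / r) ^ Suc n * C"
      using bound by simp
    have "norm (t / r) < 1" using t r by (simp add: r_def)
    then have "(\<lambda>n. (t / r) ^ Suc n) \<longlonglongrightarrow> 0" by (intro LIMSEQ_Suc LIMSEQ_power_zero)
    then show "(\<lambda>n. K * (t / r) ^ Suc n * C) \<longlonglongrightarrow> 0"
      by (intro tendsto_mult_left_zero tendsto_mult_right_zero)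
  qed simp
qed

text \<open>
  Optional stopping at the exit from the half-plane. Leaving after a walk \<open>u\<close> costs the factor
  \<open>weight t x y [South] * h South\<close>, because \<open>u\<close> ends at height 0; the single south step accounts for the
  missing term in the numerator.
\<close>
lemma H_star_value:
  assumes ap: "aperiodic R" and x: "0 < x" and y: "0 < y" "y < y'" and t: "0 < t" "t < rho R x y'"
    and h: "harmonic R t x y h"
  shows "(weight t x 0 has_sum
      (\<Sum>j\<in>- {South}. weight t x y [j] * h j) / (weight t x y [South] * h South))
    (\<Union>\<phi>\<in>{\<phi>. R \<phi> South}. H_walks R \<phi>)"
proof -
  have hpos: "0 < h i" for i using h by (simp add: harmonic_def)
  have wpos: "0 < weight t x y w" for w by (intro weight_pos t x y)
  define f where "f w = weight t x y w * h (last w)" for w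
  have fpos: "0 < f w" for w unfolding f_def by (intro mult_pos_pos wpos hpos)
  let ?E = "(\<lambda>u. u @ [South]) ` ready_to_exit R"
  have f1: "f [j] = weight t x y [j] * h j" for j by (simp add: f_def)
  have "(f has_sum (\<Sum>j\<in>UNIV. f [j])) (stopped R UNIV above_axis)"
  proof (rule total_mass_stopped)
    show "0 \<le> f w" for w by (rule less_imp_le[OF fpos])
    show "(\<lambda>n. sum f (surviving R UNIV above_axis (Suc n))) \<longlonglongrightarrow> 0"
      unfolding f_def[abs_def] by (rule half_plane_decay[OF ap x y t hpos])
    show "(\<Sum>j | R (last u) j. f (u @ [j])) = f u" for u
      unfolding f_def by (rule harmonic_step[OF h x y(1)])
  qed
  moreover have split: "(\<Sum>j\<in>UNIV. f [j]) = f [South] + (\<Sum>j\<in>- {South}. f [j])"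
    by (simp add: sum.remove[of UNIV South] Compl_eq_Diff_UNIV)
  ultimately have total: "(f has_sum f [South] + (\<Sum>j\<in>- {South}. f [j])) ({[South]} \<union> ?E)"
    by (simp add: half_plane_exits)
  have "[South] \<notin> ?E" by (auto simp: ready_to_exit_def H_walks_def walks_def)
  moreover have E: "(f has_sum infsum f ?E) ?E"
    by (intro has_sum_infsum summable_on_subset_banach[OF has_sum_imp_summable[OF total]]) auto
  ultimately have "(f has_sum f [South] + infsum f ?E) ({[South]} \<union> ?E)"
    by (intro has_sum_Un_disjoint) (auto intro: has_sum_finiteI)
  with total have "infsum f ?E = (\<Sum>j\<in>- {South}. f [j])"
    using has_sum_unique by fastforce
  with E have "(f has_sum (\<Sum>j\<in>- {South}. f [j])) ?E" by simp
  then have *: "((\<lambda>u. f (u @ [South])) has_sum (\<Sum>j\<in>- {South}. f [j])) (ready_to_exit R)"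
    by (subst (asm) has_sum_reindex) (auto simp: inj_on_def o_def)
  have "((\<lambda>u. f (u @ [South]) * (1 / f [South])) has_sum (\<Sum>j\<in>- {South}. f [j]) * (1 / f [South]))
      (ready_to_exit R)"
    by (rule has_sum_cmult_left[OF *])
  also have "?this \<longleftrightarrow> (weight t x 0 has_sum (\<Sum>j\<in>- {South}. f [j]) * (1 / f [South]))
      (\<Union>\<phi>\<in>{\<phi>. R \<phi> South}. H_walks R \<phi>)"
  proof (rule has_sum_cong_neutral)
    fix u
    show "weight t x 0 u = 0" if "u \<in> (\<Union>\<phi>\<in>{\<phi>. R \<phi> South}. H_walks R \<phi>) - ready_to_exit R"
    proof -
      have "snd (endpoint u) \<noteq> 0" using that by (auto simp: ready_to_exit_def)
      then show ?thesis by (simp add: weight_def)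
    qed
    show "f (u @ [South]) * (1 / f [South]) = weight t x 0 u"
      if "u \<in> ready_to_exit R \<inter> (\<Union>\<phi>\<in>{\<phi>. R \<phi> South}. H_walks R \<phi>)"
    proof -
      have "snd (endpoint u) = 0" using that by (auto simp: ready_to_exit_def)
      moreover have "f (u @ [South]) = weight t x y u * f [South]"
        using x y by (simp add: f_def weight_append)
      ultimately show ?thesis using fpos[of "[South]"] by (simp add: weight_def)
    qed
  qed (auto simp: ready_to_exit_def)
  finally show ?thesis by (simp add: f1)
qed

theorem lemma12:
  fixes R :: rule and t x :: real and \<theta> :: step
  assumes "aperiodic R"
    and "vertically_unbounded R"
    and "0 < x"
    and "0 < t" and "t < kappa R x"
  shows "(\<forall>\<phi>. R \<phi> South \<longrightarrow> weight t x 0 summable_on H_walks R \<phi>) \<and>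
    weight t x (upsilon_minus R t x) summable_on C_walks R \<theta> \<and>
    weight t x (upsilon_minus R t x) summable_on D_walks R \<theta> \<and>
    gf (D_walks R \<theta>) t x (upsilon_minus R t x) \<noteq> 0 \<and>
    H_star R t x 0 =
      gf (C_walks R \<theta>) t x (upsilon_minus R t x) / gf (D_walks R \<theta>) t x (upsilon_minus R t x)"
proof -
  define y where "y = upsilon_minus R t x"
  have y: "0 < y" "y < tau R x" "rho R x y = t"
    unfolding y_def by (intro upsilon_minus_props assms)+
  obtain h where h: "harmonic R t x y h"
    using rho_harmonic[OF assms(1,3) y(1)] y(3) by blast
  have hpos: "0 < h i" for i using h by (simp add: harmonic_def)
  have wpos: "0 < weight t x y w" for w by (intro weight_pos assms y)
  let ?num = "\<Sum>j\<in>- {South}. weight t x y [j] * h j"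
  let ?den = "weight t x y [South] * h South"
  have C: "(weight t x y has_sum ?num / h \<theta>) (C_walks R \<theta>)"
    unfolding C_walks_stopped by (rule first_passage_has_sum[OF assms(1) h assms(3) y(1)])
  have D: "(weight t x y has_sum ?den / h \<theta>) (D_walks R \<theta>)"
    using first_passage_has_sum[OF assms(1) h assms(3) y(1), of "{South}" \<theta>]
    unfolding D_walks_stopped by simp
  have H: "(weight t x 0 has_sum ?num / ?den) (\<Union>\<phi>\<in>{\<phi>. R \<phi> South}. H_walks R \<phi>)"
    using assms(5) unfolding kappa_def by (rule H_star_value[OF assms(1,3) y(1,2) assms(4) _ h])
  have sm: "weight t x 0 summable_on H_walks R \<phi>" if "R \<phi> South" for \<phi>
    by (rule summable_on_subset_banach[OF has_sum_imp_summable[OF H]]) (use that in auto)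
  have "(weight t x 0 has_sum (\<Sum>\<phi>\<in>{\<phi>. R \<phi> South}. infsum (weight t x 0) (H_walks R \<phi>)))
      (\<Union>\<phi>\<in>{\<phi>. R \<phi> South}. H_walks R \<phi>)"
    by (intro sum_has_sum has_sum_infsum sm) (auto simp: H_walks_def)
  then have "H_star R t x 0 = ?num / ?den"
    unfolding H_star_def gf_def by (rule has_sum_unique[OF _ H])
  moreover have "gf (C_walks R \<theta>) t x y = ?num / h \<theta>" "gf (D_walks R \<theta>) t x y = ?den / h \<theta>"
    unfolding gf_def by (rule infsumI[OF C], rule infsumI[OF D])
  moreover have "?den / h \<theta> \<noteq> 0" "?num / ?den = (?num / h \<theta>) / (?den / h \<theta>)"
    using hpos wpos by (auto simp: less_imp_neq[THEN not_sym])
  ultimately show ?thesis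
    unfolding y_def[symmetric] using sm has_sum_imp_summable[OF C] has_sum_imp_summable[OF D] by simp
qed

end
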